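(* Consider the inclusion process on a finite set $S$ with underlying rates $r$ and parameter $d_N$ with $\lim_{N\to\infty}d_N\log N=0$, and suppose the process exhibits condensation. (a) If $S_0$ has only one irreducible component, then $S_\star=S_0$ and $\lim_{N\to\infty}\mu_N(\xi_N^x)=\nu(x)$ for all $x\in S_\star$, where $\nu$ is the unique invariant probability measure of the (irreducible) continuous-time Markov chain on $S_\star$ with rates $a(x,y)=[r(x,y)-r(y,x)]\mathbf 1\{r(x,y)>r(y,x)\}$. (b) If $r(x,y)=r(y,x)$ for all $x,y\in S_0$, the continuous-time Markov chain on $S_0$ with rates $r(x,y)$ is irreducible, and $S_0$ is attracting, then $S_\star=S_0$ and $\lim_{N\to\infty}\mu_N(\xi_N^x)=\nu(x)$ for all $x\in S_\star$, where $\nu$ is the unique invariant probability measure of the continuous-time Markov chain on $S_\star$ with rates $r(x,y)$.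
   Context: $S$ is finite; $r:S\times S\to[0,\infty)$, $r(x,x)=0$, are the rates of an irreducible continuous-time Markov chain on $S$. $\mathcal H_N=\{\eta\in\{0,1,2,\dots\}^S:\sum_x\eta_x=N\}$; $\sigma^{x,y}\eta$ moves one particle from $x$ to $y$ (if $\eta_x\ge1$; else $\sigma^{x,y}\eta=\eta$). With $d_N>0$, $d_N\to0$, the inclusion process has generator $(\mathcal L_NF)(\eta)=\sum_{x\ne y}\eta_x(d_N+\eta_y)r(x,y)\{F(\sigma^{x,y}\eta)-F(\eta)\}$ on $\mathcal H_N$ and unique invariant probability measure $\mu_N$. $\xi_N^x$: configuration with all $N$ particles at $x$; $\mathcal E_N=\{\xi_N^x:x\in S\}$. Condensation: $\lim_N\mu_N(\mathcal E_N)=1$; $S_\star=\{x:\limsup_N\mu_N(\{\xi_N^x\})>0\}$. $S_0$: recurrent states of the Markov chain $Z_1$ on $S$ with rates $b(x,y)=[r(x,y)-r(y,x)]\mathbf 1\{r(x,y)>r(y,x)\}$; "$S_0$ has only one irreducible component" means $Z_1$ restricted to $S_0$ is irreducible (for all $x,y\in S_0$ there is a path $x=z_0,z_1,\dots,z_k=y$ in $S_0$ with $\prod b(z_{i-1},z_i)>0$). $A\subseteq S$ is attracting if $r(x,y)<r(y,x)$ for all $x\in A$, $y\notin A$ with $r(x,y)+r(y,x)>0$. *)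

theory Defs
  imports "HOL-Analysis.Analysis" "HOL-Library.Liminf_Limsup" "HOL-Library.Extended_Real"
begin

text \<open>Site set S is the finite type 'a (S = UNIV). Rates r :: 'a => 'a => real.\<close>

definition rates :: "('a::finite \<Rightarrow> 'a \<Rightarrow> real) \<Rightarrow> bool" where
  "rates r \<longleftrightarrow> (\<forall>x y. r x y \<ge> 0) \<and> (\<forall>x. r x x = 0)"

text \<open>Irreducibility of the Markov chain with rates q restricted to the set A:
  any two states of A are joined by a path inside A with positive rates.\<close>
definition irreducible_on :: "'a set \<Rightarrow> ('a \<Rightarrow> 'a \<Rightarrow> real) \<Rightarrow> bool" where
  "irreducible_on A q \<longleftrightarrow>
     (\<forall>x\<in>A. \<forall>y\<in>A. (x, y) \<in> ({(u, v). q u v > 0} \<inter> (A \<times> A))\<^sup>*)"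

text \<open>Configurations with N particles.\<close>
definition configs :: "nat \<Rightarrow> ('a::finite \<Rightarrow> nat) set" where
  "configs N = {\<eta>. (\<Sum>x\<in>UNIV. \<eta> x) = N}"

definition move :: "'a \<Rightarrow> 'a \<Rightarrow> ('a \<Rightarrow> nat) \<Rightarrow> ('a \<Rightarrow> nat)" where
  "move x y \<eta> = (if \<eta> x \<ge> 1 then (\<eta>(x := \<eta> x - 1))(y := (\<eta>(x := \<eta> x - 1)) y + 1) else \<eta>)"

text \<open>Generator of the inclusion process.\<close>
definition gen :: "('a::finite \<Rightarrow> 'a \<Rightarrow> real) \<Rightarrow> real \<Rightarrow> (('a \<Rightarrow> nat) \<Rightarrow> real) \<Rightarrow> ('a \<Rightarrow> nat) \<Rightarrow> real" where
  "gen r d F \<eta> = (\<Sum>x\<in>UNIV. \<Sum>y\<in>UNIV - {x}.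
      real (\<eta> x) * (d + real (\<eta> y)) * r x y * (F (move x y \<eta>) - F \<eta>))"

text \<open>mu is an invariant probability measure (as a mass function on configs N)
  of the inclusion process with N particles.\<close>
definition inv_prob_IP :: "('a::finite \<Rightarrow> 'a \<Rightarrow> real) \<Rightarrow> real \<Rightarrow> nat \<Rightarrow> (('a \<Rightarrow> nat) \<Rightarrow> real) \<Rightarrow> bool" where
  "inv_prob_IP r d N \<mu> \<longleftrightarrow>
     (\<forall>\<eta>\<in>configs N. \<mu> \<eta> \<ge> 0) \<and> (\<forall>\<eta>. \<eta> \<notin> configs N \<longrightarrow> \<mu> \<eta> = 0) \<and>
     (\<Sum>\<eta>\<in>configs N. \<mu> \<eta>) = 1 \<and>
     (\<forall>F. (\<Sum>\<eta>\<in>configs N. \<mu> \<eta> * gen r d F \<eta>) = 0)"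

text \<open>All N particles at x.\<close>
definition xi :: "nat \<Rightarrow> 'a \<Rightarrow> ('a \<Rightarrow> nat)" where
  "xi N x = (\<lambda>y. if y = x then N else 0)"

definition condensation :: "(nat \<Rightarrow> ('a::finite \<Rightarrow> nat) \<Rightarrow> real) \<Rightarrow> bool" where
  "condensation \<mu> \<longleftrightarrow> (\<lambda>N. \<Sum>x\<in>UNIV. \<mu> N (xi N x)) \<longlonglongrightarrow> 1"

definition Sstar :: "(nat \<Rightarrow> ('a::finite \<Rightarrow> nat) \<Rightarrow> real) \<Rightarrow> 'a set" where
  "Sstar \<mu> = {x. limsup (\<lambda>N. ereal (\<mu> N (xi N x))) > 0}"

text \<open>Rates b(x,y) = [r(x,y) - r(y,x)] 1{r(x,y) > r(y,x)}.\<close>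
definition brates :: "('a \<Rightarrow> 'a \<Rightarrow> real) \<Rightarrow> 'a \<Rightarrow> 'a \<Rightarrow> real" where
  "brates r x y = (if r x y > r y x then r x y - r y x else 0)"

text \<open>Recurrent states of a finite-state chain with rates q: every state reachable from x
  leads back to x.\<close>
definition recurrent_states :: "('a \<Rightarrow> 'a \<Rightarrow> real) \<Rightarrow> 'a set" where
  "recurrent_states q = {x. \<forall>y. (x, y) \<in> {(u, v). q u v > 0}\<^sup>* \<longrightarrow> (y, x) \<in> {(u, v). q u v > 0}\<^sup>*}"

definition S0 :: "('a \<Rightarrow> 'a \<Rightarrow> real) \<Rightarrow> 'a set" where
  "S0 r = recurrent_states (brates r)"

definition attracting :: "('a \<Rightarrow> 'a \<Rightarrow> real) \<Rightarrow> 'a set \<Rightarrow> bool" where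
  "attracting r A \<longleftrightarrow> (\<forall>x\<in>A. \<forall>y. y \<notin> A \<longrightarrow> r x y + r y x > 0 \<longrightarrow> r x y < r y x)"

text \<open>nu is an invariant probability measure of the chain on A with rates q (global balance).\<close>
definition inv_prob_on :: "'a set \<Rightarrow> ('a \<Rightarrow> 'a \<Rightarrow> real) \<Rightarrow> ('a \<Rightarrow> real) \<Rightarrow> bool" where
  "inv_prob_on A q \<nu> \<longleftrightarrow>
     (\<forall>x\<in>A. \<nu> x \<ge> 0) \<and> (\<forall>x. x \<notin> A \<longrightarrow> \<nu> x = 0) \<and> sum \<nu> A = 1 \<and>
     (\<forall>y\<in>A. (\<Sum>x\<in>A - {y}. \<nu> x * q x y) = \<nu> y * (\<Sum>z\<in>A - {y}. q y z))"

end

(*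
Write p_N(x) for the mass of xi_N^x and split the generator into the part without d (pure attraction)
and the part with d (diffusion).

Take F harmonic for the part without d, with F(xi_N^x) = f(x). Then gen F is bounded by a constant
times d_N N everywhere, and at xi_N^x gambler's ruin between two sites gives d_N N times
sum_y h_N(x,y) (f(y) - f(x)) with h_N(x,y) -> b(x,y). Stationarity and condensation therefore force
every limit point of p_N to be invariant for the rates b. This settles (a) and shows that p_N(y) -> 0
for y outside S_0.

In (b) the rates b vanish on S_0 and the next order is needed. Test functions that are polynomials of
degree at most three in the densities eta_x/N show that, for x in S_0 and y outside S_0,
E[eta_x eta_y] (r(y,x) - r(x,y)) = d_N N (p_N(x) r(x,y) + o(1)): what diffuses from the condensate at x
to y returns to x. Inserting this into E[gen eta_x] = 0 leaves the balance equations of r on S_0.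
*)
theory Submission
  imports Defs

begin

section \<open>Finite Markov chains\<close>

text \<open>Condensation comes without a rate, so an expectation reduces to the condensed
  configurations only for observables bounded uniformly in \<open>N\<close>. The part of the
  generator with \<open>d\<close> is of this kind after normalisation; the part without
  \<open>d\<close>, of order \<open>N^2\<close>, is not. In (a) harmonicity removes it. In (b)
  polynomials make it explicit, and its expectations, weighted by \<open>real N / d N\<close>,
  become unknowns to be estimated from further balance relations. The anchor is
  \<open>drain_total\<close>, the net flow into \<open>A\<close>: testing with the mass off
  \<open>A\<close> bounds its weighted expectation, and testing with the square of that mass shows
  that one more factor \<open>off_mass\<close> makes it vanish. The obstacle left is that
  \<open>drain N y\<close> lumps together all sites of \<open>A\<close>. A cubic test function shows
  that two sites of \<open>A\<close> and one outside are jointly negligible, which isolates the site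
  carrying the condensate. Limits are identified along subsequences only, so existence of the
  invariant measure is a by-product of compactness.\<close>

text \<open>Positive inflow from \<open>v\<close> must be matched by outflow from \<open>w\<close>,
  so \<open>\<rho> w\<close> cannot vanish; irreducibility carries this along paths.
  \<open>\<rho>\<close> is any nonnegative balanced weight, so that differences of invariant
  measures are covered.\<close>

lemma balance_pos_propagates:
  fixes q :: "'a::finite \<Rightarrow> 'a \<Rightarrow> real"
  assumes irr: "irreducible_on A q" and q: "\<And>x y. q x y \<ge> 0"
    and nn: "\<And>x. x \<in> A \<Longrightarrow> \<rho> x \<ge> 0"
    and bal: "\<And>y. y \<in> A \<Longrightarrow> (\<Sum>x\<in>A - {y}. \<rho> x * q x y) = \<rho> y * (\<Sum>z\<in>A - {y}. q y z)"
    and u: "u \<in> A" "\<rho> u > 0" and x: "x \<in> A"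
  shows "\<rho> x > 0"
proof -
  have "(u, x) \<in> ({(u, v). q u v > 0} \<inter> (A \<times> A))\<^sup>*"
    using irr u x by (auto simp: irreducible_on_def)
  then show ?thesis
  proof (induction rule: rtrancl_induct)
    case base
    show ?case by (fact u)
  next
    case (step v w)
    show ?case
    proof (cases "v = w")
      case True
      with step show ?thesis by simp
    next
      case False
      have "0 < \<rho> v * q v w" using step by auto
      also have "\<dots> \<le> (\<Sum>x\<in>A - {w}. \<rho> x * q x w)"
        using step False q nn by (intro member_le_sum) auto
      also have "\<dots> = \<rho> w * (\<Sum>z\<in>A - {w}. q w z)" using bal step by auto
      finally have "\<rho> w \<noteq> 0" by auto
      then show ?thesis using nn[of w] step by auto
    qed
  qed
qed

lemma inv_prob_on_pos:
  fixes q :: "'a::finite \<Rightarrow> 'a \<Rightarrow> real"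
  assumes "irreducible_on A q" and "\<And>x y. q x y \<ge> 0" and inv: "inv_prob_on A q \<nu>" and "x \<in> A"
  shows "\<nu> x > 0"
proof -
  have "\<exists>u\<in>A. \<nu> u > 0"
  proof (rule ccontr)
    assume "\<not> ?thesis"
    then have "sum \<nu> A \<le> 0" by (intro sum_nonpos) (auto simp: not_less)
    then show False using inv by (simp add: inv_prob_on_def)
  qed
  then obtain u where "u \<in> A" "\<nu> u > 0" by auto
  then show ?thesis
    using balance_pos_propagates[of A q \<nu> u x] assms by (auto simp: inv_prob_on_def)
qed

lemma inv_prob_on_unique:
  fixes q :: "'a::finite \<Rightarrow> 'a \<Rightarrow> real"
  assumes irr: "irreducible_on A q" and q: "\<And>x y. q x y \<ge> 0"
    and \<nu>: "inv_prob_on A q \<nu>" and \<nu>': "inv_prob_on A q \<nu>'"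
  shows "\<nu> = \<nu>'"
proof -
  have ne: "A \<noteq> {}" using \<nu> by (auto simp: inv_prob_on_def)
  have pos: "\<nu> x > 0" if "x \<in> A" for x using inv_prob_on_pos[OF irr q \<nu> that] .
  \<comment> \<open>\<open>t\<close> is the largest multiple of \<open>\<nu>\<close> that stays
    below \<open>\<nu>'\<close> on \<open>A\<close>; the difference vanishes at the minimiser
    \<open>x0\<close>, hence on all of \<open>A\<close> by propagation of positivity.\<close>
  define t where "t = Min ((\<lambda>x. \<nu>' x / \<nu> x) ` A)"
  have "t \<in> (\<lambda>x. \<nu>' x / \<nu> x) ` A" unfolding t_def using ne by (intro Min_in) auto
  then obtain x0 where x0: "x0 \<in> A" "t = \<nu>' x0 / \<nu> x0" by auto
  define \<rho> where "\<rho> x = \<nu>' x - t * \<nu> x" for x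
  have nn: "\<rho> x \<ge> 0" if "x \<in> A" for x
  proof -
    have "t \<le> \<nu>' x / \<nu> x" unfolding t_def using that by (intro Min_le) auto
    then show ?thesis using pos[OF that] by (simp add: \<rho>_def field_simps)
  qed
  have bal: "(\<Sum>x\<in>A - {y}. \<rho> x * q x y) = \<rho> y * (\<Sum>z\<in>A - {y}. q y z)" if "y \<in> A" for y
  proof -
    have "(\<Sum>x\<in>A - {y}. \<rho> x * q x y)
        = (\<Sum>x\<in>A - {y}. \<nu>' x * q x y) - t * (\<Sum>x\<in>A - {y}. \<nu> x * q x y)"
      by (simp add: \<rho>_def left_diff_distrib sum_subtractf sum_distrib_left mult.assoc)
    then show ?thesis using \<nu> \<nu>' that
      by (simp add: inv_prob_on_def \<rho>_def left_diff_distrib)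
  qed
  have "\<rho> x0 = 0" using x0 pos[of x0] by (simp add: \<rho>_def)
  then have zero: "\<rho> x = 0" if "x \<in> A" for x
    using balance_pos_propagates[OF irr q nn bal that _ x0(1)] nn[OF that] by force
  have "sum \<rho> A = 1 - t"
    using \<nu> \<nu>' by (simp add: \<rho>_def sum_subtractf sum_distrib_left[symmetric] inv_prob_on_def)
  then have "t = 1" using zero by simp
  then have "\<nu> x = \<nu>' x" for x
    using zero[of x] \<nu> \<nu>' by (cases "x \<in> A") (auto simp: \<rho>_def inv_prob_on_def)
  then show ?thesis by auto
qed

section \<open>Compactness and identification of limits\<close>

lemma pointwise_convergent_subseq:
  fixes P :: "nat \<Rightarrow> 'a::finite \<Rightarrow> real"
  assumes "\<And>N x. \<bar>P N x\<bar> \<le> C"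
  obtains s p where "strict_mono s" "\<And>x. (\<lambda>k. P (s k) x) \<longlonglongrightarrow> p x"
proof -
  \<comment> \<open>Functions on the finite type become vectors, so that Bolzano-Weierstrass applies
    to all coordinates at once.\<close>
  define X where "X N = (\<chi> x. P N x)" for N
  have "norm (X N) \<le> real CARD('a) * C" for N
    using norm_le_l1_cart[of "X N"] sum_bounded_above[of UNIV "\<lambda>x. \<bar>P N x\<bar>" C] assms
    by (simp add: X_def)
  then have "bounded (range X)" by (auto simp: bounded_iff)
  then obtain l s where s: "strict_mono s" "(X \<circ> s) \<longlonglongrightarrow> l"
    using bounded_imp_convergent_subsequence by blast
  have "(\<lambda>k. P (s k) x) \<longlonglongrightarrow> l $ x" for x
    using tendsto_vec_nth[OF s(2), of x] by (simp add: X_def o_def)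
  with s(1) show thesis by (rule that)
qed

text \<open>Only coordinate \<open>y\<close> of the limit is prescribed, but \<open>lim\<close>
  speaks of subsequences along which all coordinates converge, because limits are identified as
  whole measures.\<close>

lemma tendsto_if_subseq_limits:
  fixes P :: "nat \<Rightarrow> 'a::finite \<Rightarrow> real"
  assumes bd: "\<And>N x. \<bar>P N x\<bar> \<le> C"
    and lim: "\<And>s p. strict_mono s \<Longrightarrow> (\<And>x. (\<lambda>k. P (s k) x) \<longlonglongrightarrow> p x) \<Longrightarrow> p y = c"
  shows "(\<lambda>N. P N y) \<longlonglongrightarrow> c"
proof (rule ccontr)
  assume "\<not> ?thesis"
  then obtain e where e: "e > 0" and "\<And>n. \<exists>m\<ge>n. dist (P m y) c \<ge> e"
    by (auto simp: lim_sequentially not_less)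
  then have "infinite {m. dist (P m y) c \<ge> e}"
    by (auto simp: infinite_nat_iff_unbounded_le)
  then obtain s0 :: "nat \<Rightarrow> nat" where s0: "strict_mono s0" "\<And>n. dist (P (s0 n) y) c \<ge> e"
    using infinite_enumerate by blast
  obtain s p where s: "strict_mono s" "\<And>x. (\<lambda>k. P (s0 (s k)) x) \<longlonglongrightarrow> p x"
    using pointwise_convergent_subseq[of "\<lambda>n. P (s0 n)" C] bd by auto
  have "p y = c"
    using lim[of "s0 \<circ> s" p] s s0 strict_mono_o by (auto simp: o_def)
  then have "\<forall>\<^sub>F k in sequentially. dist (P (s0 (s k)) y) c < e"
    using s(2)[of y] e by (auto simp: tendsto_iff)
  then show False using s0(2) by (auto simp: eventually_sequentially not_less[symmetric])
qed

text \<open>A limit point supplied by compactness is itself the invariant measure whose existence is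
  claimed. Uniqueness makes all limit points agree, and strict positivity on \<open>A\<close>
  identifies \<open>Sstar\<close>.\<close>

lemma convergence_from_subseq_limits:
  fixes \<mu> :: "nat \<Rightarrow> ('a::finite \<Rightarrow> nat) \<Rightarrow> real"
  assumes irr: "irreducible_on A q" and q: "\<And>x y. q x y \<ge> 0"
    and bd: "\<And>N x. \<bar>\<mu> N (xi N x)\<bar> \<le> C"
    and lim: "\<And>s p. strict_mono s \<Longrightarrow> (\<And>x. (\<lambda>k. \<mu> (s k) (xi (s k) x)) \<longlonglongrightarrow> p x)
               \<Longrightarrow> inv_prob_on A q p"
  shows "Sstar \<mu> = A \<and> (\<exists>!\<nu>. inv_prob_on (Sstar \<mu>) q \<nu>) \<and>
            (\<forall>\<nu>. inv_prob_on (Sstar \<mu>) q \<nu> \<longrightarrow>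
                 (\<forall>x\<in>Sstar \<mu>. (\<lambda>N. \<mu> N (xi N x)) \<longlonglongrightarrow> \<nu> x))"
proof -
  obtain s \<nu> where "strict_mono s" "\<And>x. (\<lambda>k. \<mu> (s k) (xi (s k) x)) \<longlonglongrightarrow> \<nu> x"
    using pointwise_convergent_subseq[of "\<lambda>N x. \<mu> N (xi N x)", OF bd] by blast
  then have \<nu>: "inv_prob_on A q \<nu>" by (rule lim)
  have uniq: "\<nu>' = \<nu>" if "inv_prob_on A q \<nu>'" for \<nu>'
    using inv_prob_on_unique[OF irr q that \<nu>] .
  have conv: "(\<lambda>N. \<mu> N (xi N x)) \<longlonglongrightarrow> \<nu> x" for x
    using tendsto_if_subseq_limits[of "\<lambda>N x. \<mu> N (xi N x)", OF bd, of x "\<nu> x"] lim uniq by blast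
  have "limsup (\<lambda>N. ereal (\<mu> N (xi N x))) = ereal (\<nu> x)" for x
    using conv[of x] by (intro lim_imp_Limsup) auto
  moreover have "\<nu> x > 0 \<longleftrightarrow> x \<in> A" for x
    using inv_prob_on_pos[OF irr q \<nu>, of x] \<nu> by (auto simp: inv_prob_on_def)
  ultimately have S: "Sstar \<mu> = A" by (auto simp: Sstar_def)
  show ?thesis unfolding S using \<nu> uniq conv by metis
qed

section \<open>Stationarity and recurrent states\<close>

text \<open>Stationarity in weak form, tested on indicators of sets. Test functions of the process
  deliver it in this form; singletons \<open>C\<close> give balance, closed sets \<open>C\<close>
  exclude mass on transient states.\<close>

definition stationary :: "('a::finite \<Rightarrow> 'a \<Rightarrow> real) \<Rightarrow> ('a \<Rightarrow> real) \<Rightarrow> bool" where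
  "stationary q p \<longleftrightarrow>
     (\<forall>C. (\<Sum>x\<in>UNIV. p x * (\<Sum>y\<in>UNIV. q x y * (of_bool (y \<in> C) - of_bool (x \<in> C)))) = 0)"

lemma stationary_balance:
  assumes "stationary q p"
  shows "(\<Sum>x\<in>UNIV - {y}. p x * q x y) = p y * (\<Sum>z\<in>UNIV - {y}. q y z)"
proof -
  have *: "(\<Sum>v\<in>UNIV. q x v * (of_bool (v \<in> {y}) - of_bool (x \<in> {y})))
    = (if x = y then - (\<Sum>z\<in>UNIV - {y}. q y z) else q x y)" for x
  proof (cases "x = y")
    case True
    have "(\<Sum>v\<in>UNIV. q x v * (of_bool (v \<in> {y}) - of_bool (x \<in> {y})))
        = (\<Sum>v\<in>UNIV - {y}. - q y v)"
      using True by (intro sum.mono_neutral_cong_right) auto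
    then show ?thesis using True by (simp add: sum_negf)
  next
    case False
    have "(\<Sum>v\<in>UNIV. q x v * (of_bool (v \<in> {y}) - of_bool (x \<in> {y})))
        = (\<Sum>v\<in>{y}. q x v)"
      using False by (intro sum.mono_neutral_cong_right) auto
    then show ?thesis using False by simp
  qed
  have "0 = (\<Sum>x\<in>UNIV. p x * (if x = y then - (\<Sum>z\<in>UNIV - {y}. q y z) else q x y))"
    using assms unfolding stationary_def * [symmetric] by metis
  also have "\<dots> = - p y * (\<Sum>z\<in>UNIV - {y}. q y z) + (\<Sum>x\<in>UNIV - {y}. p x * q x y)"
    by (subst sum.remove[of _ y]) (auto intro!: sum.cong)
  finally show ?thesis by simp
qed

lemma stationary_transient_zero:
  assumes st: "stationary q p" and q: "\<And>x y. q x y \<ge> 0" and p: "\<And>x. p x \<ge> 0"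
    and x: "x \<notin> recurrent_states q"
  shows "p x = 0"
proof (rule ccontr)
  assume nz: "p x \<noteq> 0"
  let ?E = "{(u, v). q u v > 0}"
  obtain y where y: "(x, y) \<in> ?E\<^sup>*" "(y, x) \<notin> ?E\<^sup>*"
    using x by (auto simp: recurrent_states_def)
  \<comment> \<open>\<open>C\<close> has no exits, so in the stationarity identity for
    \<open>C\<close> every summand is nonnegative and hence zero: no mass can enter \<open>C\<close>
    either.\<close>
  define C where "C = {z. (y, z) \<in> ?E\<^sup>*}"
  have C: "v \<in> C" if "u \<in> C" "q u v > 0" for u v
    using that rtrancl.rtrancl_into_rtrancl[of y u ?E v] by (auto simp: C_def)
  have nn: "q u v * (of_bool (v \<in> C) - of_bool (u \<in> C)) \<ge> 0" for u v
    using C[of u v] q[of u v] by (cases "q u v = 0") auto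
  have zero: "p u * q u v = 0" if "u \<notin> C" "v \<in> C" for u v
  proof -
    have "(\<Sum>u\<in>UNIV. p u * (\<Sum>v\<in>UNIV. q u v * (of_bool (v \<in> C) - of_bool (u \<in> C)))) = 0"
      using st by (auto simp: stationary_def)
    then have "p u * (\<Sum>v\<in>UNIV. q u v * (of_bool (v \<in> C) - of_bool (u \<in> C))) = 0"
      using sum_nonneg_eq_0_iff[of UNIV "\<lambda>u. p u * (\<Sum>v\<in>UNIV. q u v * (of_bool (v \<in> C) - of_bool (u \<in> C)))"]
        p nn by (simp add: sum_nonneg)
    then have "p u = 0 \<or> (\<forall>v. q u v * (of_bool (v \<in> C) - of_bool (u \<in> C)) = 0)"
      by (auto simp: sum_nonneg_eq_0_iff nn)
    then show ?thesis using that by force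
  qed
  \<comment> \<open>Along the path from \<open>x\<close> the mass stays positive and outside
    \<open>C\<close>, yet the path ends at \<open>y\<close>, which lies in \<open>C\<close>.\<close>
  have "p y > 0 \<and> y \<notin> C" using y(1)
  proof (induction rule: rtrancl_induct)
    case base
    show ?case using nz p[of x] y(2) by (auto simp: C_def)
  next
    case (step v w)
    then have qvw: "q v w > 0" "p v > 0" "v \<notin> C" by auto
    then have w: "w \<notin> C" using zero[of v w] by auto
    have "p w > 0"
    proof (cases "v = w")
      case False
      have "0 < p v * q v w" using qvw by simp
      also have "\<dots> \<le> (\<Sum>u\<in>UNIV - {w}. p u * q u w)"
        using False p q by (intro member_le_sum) auto
      also have "\<dots> = p w * (\<Sum>z\<in>UNIV - {w}. q w z)" by (rule stationary_balance[OF st])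
      finally show ?thesis using p[of w] by (cases "p w = 0") auto
    qed (use qvw in auto)
    with w show ?case by simp
  qed
  then show False by (auto simp: C_def)
qed

lemma recurrent_states_closed:
  assumes "x \<in> recurrent_states q" "q x y > 0"
  shows "y \<in> recurrent_states q"
proof -
  let ?E = "{(u, v). q u v > 0}"
  have xy: "(x, y) \<in> ?E" using assms by auto
  have "(z, y) \<in> ?E\<^sup>*" if "(y, z) \<in> ?E\<^sup>*" for z
  proof -
    have "(x, z) \<in> ?E\<^sup>*" using xy that by (rule converse_rtrancl_into_rtrancl)
    then have "(z, x) \<in> ?E\<^sup>*" using assms by (auto simp: recurrent_states_def)
    then show ?thesis using xy by (rule rtrancl_into_rtrancl)
  qed
  then show ?thesis by (auto simp: recurrent_states_def)
qed

lemma stationary_inv_prob_on_recurrent: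
  assumes st: "stationary q p" and q: "\<And>x y. q x y \<ge> 0" and p: "\<And>x. p x \<ge> 0"
    and one: "sum p UNIV = 1"
  shows "inv_prob_on (recurrent_states q) q p"
proof -
  let ?A = "recurrent_states q"
  have z: "p x = 0" if "x \<notin> ?A" for x using stationary_transient_zero[OF st q p that] .
  have c: "q x y = 0" if "x \<in> ?A" "y \<notin> ?A" for x y
    using recurrent_states_closed[OF that(1), of y] that(2) q[of x y] by force
  have "sum p ?A = sum p UNIV" by (rule sum.mono_neutral_left) (auto simp: z)
  moreover have "(\<Sum>x\<in>?A - {y}. p x * q x y) = p y * (\<Sum>z\<in>?A - {y}. q y z)" if "y \<in> ?A" for y
  proof -
    have "(\<Sum>x\<in>?A - {y}. p x * q x y) = (\<Sum>x\<in>UNIV - {y}. p x * q x y)"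
      by (rule sum.mono_neutral_left) (use z in auto)
    moreover have "(\<Sum>z\<in>?A - {y}. q y z) = (\<Sum>z\<in>UNIV - {y}. q y z)"
      by (rule sum.mono_neutral_left) (use c[OF that] in auto)
    ultimately show ?thesis using stationary_balance[OF st, of y] by simp
  qed
  ultimately show ?thesis using p z one by (auto simp: inv_prob_on_def)
qed

section \<open>Harmonic functions of the process without diffusion\<close>

lemma configs_le: "\<eta> \<in> configs N \<Longrightarrow> \<eta> x \<le> N"
  using member_le_sum[of x UNIV \<eta>] by (auto simp: configs_def)

lemma finite_configs: "finite (configs N :: ('a::finite \<Rightarrow> nat) set)"
proof (rule finite_subset)
  show "(configs N :: ('a \<Rightarrow> nat) set) \<subseteq> PiE UNIV (\<lambda>_. {..N})"
    by (auto simp: PiE_UNIV_domain Pi_iff intro: configs_le)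
  show "finite (PiE UNIV (\<lambda>_. {..N}) :: ('a \<Rightarrow> nat) set)"
    by (intro finite_PiE) auto
qed

lemma xi_in_configs: "xi N x \<in> configs N"
  by (auto simp: configs_def xi_def)

lemma inj_xi: "N > 0 \<Longrightarrow> inj (xi N)"
  by (rule injI) (metis neq0_conv xi_def)

text \<open>Stated in the reals to avoid truncated subtraction. Constant \<open>f\<close> gives
  conservation of particles, general \<open>f\<close> the increments of
  \<open>dens_avg\<close>.\<close>

lemma sum_mult_move:
  fixes f :: "'a::finite \<Rightarrow> real"
  assumes "\<eta> x \<ge> 1"
  shows "(\<Sum>z\<in>UNIV. f z * real (move x y \<eta> z)) = (\<Sum>z\<in>UNIV. f z * real (\<eta> z)) + (f y - f x)"
proof -
  have "real (move x y \<eta> z) = real (\<eta> z) - of_bool (z = x) + of_bool (z = y)" for z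
    using assms by (auto simp: move_def)
  then have "(\<Sum>z\<in>UNIV. f z * real (move x y \<eta> z))
     = (\<Sum>z\<in>UNIV. f z * real (\<eta> z) - f z * of_bool (z = x) + f z * of_bool (z = y))"
    by (intro sum.cong refl) (simp only: distrib_left right_diff_distrib)
  then show ?thesis by (simp add: sum.distrib sum_subtractf)
qed

lemma move_in_configs:
  assumes "\<eta> \<in> configs N"
  shows "move x y \<eta> \<in> configs N"
proof (cases "\<eta> x \<ge> 1")
  case True
  have "real (\<Sum>z\<in>UNIV. move x y \<eta> z) = real (\<Sum>z\<in>UNIV. \<eta> z)"
    using sum_mult_move[of \<eta> x "\<lambda>_. 1" y] True by simp
  then have "(\<Sum>z\<in>UNIV. move x y \<eta> z) = (\<Sum>z\<in>UNIV. \<eta> z)" by (rule of_nat_eq_iff[THEN iffD1])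
  then show ?thesis using assms by (simp add: configs_def)
qed (use assms in \<open>simp add: move_def\<close>)

lemma gen_diff: "gen r d (\<lambda>\<eta>. F \<eta> - G \<eta>) \<eta> = gen r d F \<eta> - gen r d G \<eta>"
  by (simp add: gen_def sum_subtractf[symmetric] algebra_simps)

lemma gen_split:
  "gen r d F \<eta> = gen r 0 F \<eta> +
     d * (\<Sum>x\<in>UNIV. \<Sum>y\<in>UNIV - {x}. real (\<eta> x) * r x y * (F (move x y \<eta>) - F \<eta>))"
  by (simp add: gen_def sum_distrib_left sum.distrib[symmetric] algebra_simps)

text \<open>Without the \<open>d\<close>-term particles jump only to occupied sites, so condensed
  configurations are absorbing.\<close>

lemma gen0_xi: "gen r 0 F (xi N x) = 0"
  by (auto simp: gen_def xi_def intro!: sum.neutral split: if_splits)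

text \<open>Only the loss terms are negative, and \<open>(real N)\<^sup>2\<close> times the sum of
  all rates bounds the exit rate. This makes a sufficiently lazy discretisation preserve
  positivity.\<close>

lemma gen0_lower_bound:
  fixes r :: "'a::finite \<Rightarrow> 'a \<Rightarrow> real"
  assumes r: "rates r" and \<eta>: "\<eta> \<in> configs N" and F: "\<And>\<eta>. \<eta> \<in> configs N \<Longrightarrow> F \<eta> \<ge> 0"
  shows "gen r 0 F \<eta> \<ge> - ((real N)\<^sup>2 * (\<Sum>x\<in>UNIV. \<Sum>y\<in>UNIV. r x y)) * F \<eta>"
proof -
  have r0: "r x y \<ge> 0" for x y using r by (simp add: rates_def)
  have "- ((real N)\<^sup>2 * r x y * F \<eta>)
      \<le> real (\<eta> x) * (0 + real (\<eta> y)) * r x y * (F (move x y \<eta>) - F \<eta>)" for x y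
  proof -
    have "real (\<eta> x) * real (\<eta> y) * r x y * F \<eta> \<le> (real N)\<^sup>2 * r x y * F \<eta>"
      unfolding power2_eq_square using configs_le[OF \<eta>] r0 F[OF \<eta>]
      by (intro mult_right_mono mult_mono) auto
    moreover have "real (\<eta> x) * real (\<eta> y) * r x y * F (move x y \<eta>) \<ge> 0"
      using r0 F[OF move_in_configs[OF \<eta>]] by auto
    ultimately show ?thesis by (simp add: algebra_simps)
  qed
  then have "(\<Sum>x\<in>UNIV. \<Sum>y\<in>UNIV - {x}. - ((real N)\<^sup>2 * r x y * F \<eta>)) \<le> gen r 0 F \<eta>"
    unfolding gen_def by (intro sum_mono)
  moreover have "(\<Sum>x\<in>UNIV. \<Sum>y\<in>UNIV - {x}. - ((real N)\<^sup>2 * r x y * F \<eta>))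
     = - ((real N)\<^sup>2 * (\<Sum>x\<in>UNIV. \<Sum>y\<in>UNIV. r x y)) * F \<eta>"
    using r by (simp add: sum_negf sum_distrib_left sum_distrib_right sum_diff1 rates_def)
  ultimately show ?thesis by simp
qed

text \<open>The dynamics without \<open>d\<close> may have further absorbing configurations, with
  several occupied sites that exchange no particles, so a harmonic extension need not be unique.
  Monotone iteration from below selects one and gives the bounds along the way.\<close>

lemma harmonic_extension:
  fixes r :: "'a::finite \<Rightarrow> 'a \<Rightarrow> real"
  assumes r: "rates r" and N: "N > 0" and f: "\<And>x. 0 \<le> f x" "\<And>x. f x \<le> M"
  obtains F where "\<And>\<eta>. \<eta> \<in> configs N \<Longrightarrow> 0 \<le> F \<eta> \<and> F \<eta> \<le> M"
    and "\<And>\<eta>. \<eta> \<in> configs N \<Longrightarrow> gen r 0 F \<eta> = 0"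
    and "\<And>x. F (xi N x) = f x"
proof -
  \<comment> \<open>Iterate a lazy discretisation of the chain without the d-term: starting from f on the
    condensed configurations and 0 elsewhere, the iterates increase.\<close>
  define K where "K = (real N)\<^sup>2 * (\<Sum>x\<in>UNIV. \<Sum>y\<in>UNIV. r x y) + 1"
  have "(\<Sum>x\<in>UNIV. \<Sum>y\<in>UNIV. r x y) \<ge> 0" using r by (auto simp: rates_def intro!: sum_nonneg)
  then have K: "K > 0" by (auto simp: K_def intro!: add_nonneg_pos)
  define P where "P G \<eta> = G \<eta> + gen r 0 G \<eta> / K" for G \<eta>
  have P_nonneg: "P G \<eta> \<ge> 0" if "\<And>\<eta>. \<eta> \<in> configs N \<Longrightarrow> G \<eta> \<ge> 0" "\<eta> \<in> configs N" for G \<eta>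
  proof -
    have "gen r 0 G \<eta> \<ge> - (K - 1) * G \<eta>"
      using gen0_lower_bound[OF r that(2,1)] by (simp add: K_def)
    also have "- (K - 1) * G \<eta> \<ge> - K * G \<eta>" using that by (intro mult_right_mono) auto
    finally show ?thesis using K by (simp add: P_def field_simps)
  qed
  have P_diff: "P (\<lambda>\<eta>. G \<eta> - H \<eta>) \<eta> = P G \<eta> - P H \<eta>" for G H \<eta>
    by (simp add: P_def gen_diff diff_divide_distrib)
  have P_mono: "P G \<eta> \<le> P H \<eta>"
    if "\<And>\<eta>. \<eta> \<in> configs N \<Longrightarrow> G \<eta> \<le> H \<eta>" "\<eta> \<in> configs N" for G H \<eta>
    using P_nonneg[of "\<lambda>\<eta>. H \<eta> - G \<eta>" \<eta>] that by (simp add: P_diff)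
  have P_const: "P (\<lambda>_. c) \<eta> = c" for c \<eta> by (simp add: P_def gen_def)
  define g where "g \<eta> = (\<Sum>x\<in>UNIV. if \<eta> = xi N x then f x else 0)" for \<eta>
  have g_xi: "g (xi N x) = f x" for x
    using inj_eq[OF inj_xi[OF N, where 'a = 'a]] by (simp add: g_def)
  have g_other: "g \<eta> = 0" if "\<eta> \<notin> range (xi N)" for \<eta>
    using that by (auto simp: g_def intro!: sum.neutral)
  define G where "G n = (P ^^ n) g" for n
  have M: "0 \<le> M" using f[of undefined] by linarith
  have G_bd: "0 \<le> G n \<eta> \<and> G n \<eta> \<le> M" if "\<eta> \<in> configs N" for n \<eta>
    using that
  proof (induction n arbitrary: \<eta>)
    case 0
    show ?case using f M g_xi g_other by (cases "\<eta> \<in> range (xi N)") (auto simp: G_def)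
  next
    case (Suc n)
    show ?case
      using P_nonneg[of "G n" \<eta>] P_mono[of "G n" "\<lambda>_. M" \<eta>] Suc by (auto simp: G_def P_const)
  qed
  have G_xi: "G n (xi N x) = f x" for n x
    by (induction n) (auto simp: G_def g_xi P_def gen0_xi)
  have G_inc: "G n \<eta> \<le> G (Suc n) \<eta>" if "\<eta> \<in> configs N" for n \<eta>
    using that
  proof (induction n arbitrary: \<eta>)
    case 0
    show ?case
    proof (cases "\<eta> \<in> range (xi N)")
      case True
      then obtain x where "\<eta> = xi N x" by auto
      then show ?thesis using G_xi by simp
    next
      case False
      then show ?thesis using G_bd[OF 0, of "Suc 0"] g_other by (simp add: G_def)
    qed
  next
    case (Suc n)
    then show ?case using P_mono[of "G n" "G (Suc n)" \<eta>] by (simp add: G_def)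
  qed
  define F where "F \<eta> = lim (\<lambda>n. G n \<eta>)" for \<eta>
  have G_lim: "(\<lambda>n. G n \<eta>) \<longlonglongrightarrow> F \<eta>" if "\<eta> \<in> configs N" for \<eta>
  proof -
    have "convergent (\<lambda>n. G n \<eta>)"
      using G_inc[OF that] G_bd[OF that]
      by (intro Bseq_monoseq_convergent BseqI'[of _ M] incseq_imp_monoseq incseq_SucI) auto
    then show ?thesis by (simp add: F_def convergent_LIMSEQ_iff)
  qed
  show thesis
  proof
    show "0 \<le> F \<eta> \<and> F \<eta> \<le> M" if "\<eta> \<in> configs N" for \<eta>
      using G_lim[OF that] G_bd[OF that] by (auto intro: LIMSEQ_le_const LIMSEQ_le_const2)
    show "F (xi N x) = f x" for x
      using G_lim[OF xi_in_configs, of x] by (simp add: G_xi LIMSEQ_const_iff)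
    show "gen r 0 F \<eta> = 0" if "\<eta> \<in> configs N" for \<eta>
    proof -
      have "(\<lambda>n. gen r 0 (G n) \<eta>) \<longlonglongrightarrow> gen r 0 F \<eta>"
        unfolding gen_def by (intro tendsto_intros G_lim move_in_configs that)
      then have "(\<lambda>n. P (G n) \<eta>) \<longlonglongrightarrow> P F \<eta>"
        unfolding P_def using K by (intro tendsto_intros G_lim that) auto
      moreover have "(\<lambda>n. P (G n) \<eta>) \<longlonglongrightarrow> F \<eta>"
        using LIMSEQ_Suc[OF G_lim[OF that]] by (simp add: G_def)
      ultimately have "P F \<eta> = F \<eta>" by (rule LIMSEQ_unique)
      then show ?thesis using K by (simp add: P_def)
    qed
  qed
qed

section \<open>Two-site configurations and gambler's ruin\<close>

definition pair :: "nat \<Rightarrow> 'a \<Rightarrow> 'a \<Rightarrow> nat \<Rightarrow> 'a \<Rightarrow> nat" where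
  "pair N x y k = (\<lambda>z. if z = y then k else if z = x then N - k else 0)"

lemma pair_in_configs:
  fixes x y :: "'a::finite"
  assumes "x \<noteq> y" "k \<le> N"
  shows "pair N x y k \<in> configs N"
proof -
  have "(\<Sum>z\<in>UNIV. pair N x y k z) = (\<Sum>z\<in>{x, y}. pair N x y k z)"
    by (rule sum.mono_neutral_right) (auto simp: pair_def)
  then show ?thesis using assms by (simp add: configs_def pair_def)
qed

lemma pair_0: "x \<noteq> y \<Longrightarrow> pair N x y 0 = xi N x"
  by (rule ext) (simp add: pair_def xi_def)

lemma pair_N: "pair N x y N = xi N y"
  by (rule ext) (simp add: pair_def xi_def)

lemma move_pair_up:
  assumes "x \<noteq> y" "k < N"
  shows "move x y (pair N x y k) = pair N x y (Suc k)"
  using assms by (intro ext) (auto simp: pair_def move_def)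

lemma move_pair_down:
  assumes "x \<noteq> y" "k < N"
  shows "move y x (pair N x y (Suc k)) = pair N x y k"
  using assms by (intro ext) (simp add: pair_def move_def Suc_diff_Suc)

lemma move_xi:
  assumes "x \<noteq> y" "N > 0"
  shows "move x y (xi N x) = pair N x y 1"
  using move_pair_up[of x y 0 N] assms by (simp add: pair_0)

lemma sum_offdiag_two:
  fixes T :: "'a::finite \<Rightarrow> 'a \<Rightarrow> real"
  assumes "x \<noteq> y" and z: "\<And>a b. a \<noteq> b \<Longrightarrow> (a, b) \<noteq> (x, y) \<Longrightarrow> (a, b) \<noteq> (y, x) \<Longrightarrow> T a b = 0"
  shows "(\<Sum>a\<in>UNIV. \<Sum>b\<in>UNIV - {a}. T a b) = T x y + T y x"
proof -
  have "(\<Sum>a\<in>UNIV. \<Sum>b\<in>UNIV - {a}. T a b) = (\<Sum>a\<in>{x, y}. \<Sum>b\<in>UNIV - {a}. T a b)"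
    by (rule sum.mono_neutral_right) (auto intro!: sum.neutral z)
  also have "\<dots> = (\<Sum>b\<in>UNIV - {x}. T x b) + (\<Sum>b\<in>UNIV - {y}. T y b)" using assms(1) by simp
  also have "(\<Sum>b\<in>UNIV - {x}. T x b) = (\<Sum>b\<in>{y}. T x b)"
    using assms(1) by (intro sum.mono_neutral_right) (auto intro!: z)
  also have "(\<Sum>b\<in>UNIV - {y}. T y b) = (\<Sum>b\<in>{x}. T y b)"
    using assms(1) by (intro sum.mono_neutral_right) (auto intro!: z)
  finally show ?thesis by simp
qed

text \<open>Two-site configurations are closed under the dynamics without \<open>d\<close>, which
  acts on them as a birth-death chain. The common factor of both rates drops out of the harmonic
  equation.\<close>

lemma gen0_pair:
  assumes xy: "x \<noteq> y" and k: "Suc k < N"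
  shows "gen r 0 F (pair N x y (Suc k)) = real (Suc k) * real (N - Suc k) *
    (r x y * (F (pair N x y (Suc (Suc k))) - F (pair N x y (Suc k)))
      - r y x * (F (pair N x y (Suc k)) - F (pair N x y k)))"
proof -
  have px: "pair N x y (Suc k) x = N - Suc k" and py: "pair N x y (Suc k) y = Suc k"
    and pz: "\<And>z. z \<noteq> x \<Longrightarrow> z \<noteq> y \<Longrightarrow> pair N x y (Suc k) z = 0"
    using xy by (auto simp: pair_def)
  have mu: "move x y (pair N x y (Suc k)) = pair N x y (Suc (Suc k))"
    and md: "move y x (pair N x y (Suc k)) = pair N x y k"
    using move_pair_up[OF xy k] move_pair_down[OF xy, of k N] k by auto
  define T where "T a b = real (pair N x y (Suc k) a) * (0 + real (pair N x y (Suc k) b)) * r a b *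
      (F (move a b (pair N x y (Suc k))) - F (pair N x y (Suc k)))" for a b
  have "T a b = 0" if "a \<noteq> b" "(a, b) \<noteq> (x, y)" "(a, b) \<noteq> (y, x)" for a b
    using that pz[of a] pz[of b] by (cases "a \<in> {x, y}"; cases "b \<in> {x, y}") (auto simp: T_def)
  then have "gen r 0 F (pair N x y (Suc k)) = T x y + T y x"
    unfolding gen_def T_def[symmetric] by (rule sum_offdiag_two[OF xy])
  then have "gen r 0 F (pair N x y (Suc k)) =
     real (N - Suc k) * real (Suc k) * r x y * (F (pair N x y (Suc (Suc k))) - F (pair N x y (Suc k)))
   + real (Suc k) * real (N - Suc k) * r y x * (F (pair N x y k) - F (pair N x y (Suc k)))"
    by (simp only: T_def px py mu md add_0)
  then show ?thesis by algebra
qed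

text \<open>The \<open>h_N\<close> of the overview: \<open>r x y\<close> times the probability that
  a single particle at \<open>y\<close> attracts all the others before it is lost. For
  \<open>r x y = 0\<close> division by zero gives the value 0 that is wanted.\<close>

definition ruin_rate :: "('a \<Rightarrow> 'a \<Rightarrow> real) \<Rightarrow> nat \<Rightarrow> 'a \<Rightarrow> 'a \<Rightarrow> real" where
  "ruin_rate r N x y = r x y / (\<Sum>k<N. (r y x / r x y) ^ k)"

text \<open>Harmonicity makes the increments of \<open>F\<close> along the edge from
  \<open>xi N x\<close> to \<open>xi N y\<close> geometric with ratio \<open>r y x / r x y\<close>;
  telescoping over all \<open>N\<close> of them determines the first.\<close>

lemma gambler_ruin:
  assumes r: "rates r" and N: "N > 0" and xy: "x \<noteq> y"
    and harm: "\<And>\<eta>. \<eta> \<in> configs N \<Longrightarrow> gen r 0 F \<eta> = 0"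
  shows "r x y * (F (pair N x y 1) - F (xi N x)) = ruin_rate r N x y * (F (xi N y) - F (xi N x))"
proof (cases "r x y = 0")
  case False
  define D where "D k = F (pair N x y (Suc k)) - F (pair N x y k)" for k
  define \<rho> where "\<rho> = r y x / r x y"
  have pos: "r x y > 0" "r y x \<ge> 0" using r False by (auto simp: rates_def less_le)
  have D: "D k = \<rho> ^ k * D 0" if "k < N" for k
    using that
  proof (induction k)
    case (Suc k)
    have "r x y * D (Suc k) = r y x * D k"
      using harm[OF pair_in_configs[OF xy, of "Suc k" N]] gen0_pair[OF xy Suc.prems, of r F]
        Suc.prems by (simp add: D_def)
    then have "D (Suc k) = \<rho> * D k" using pos by (simp add: \<rho>_def field_simps)
    then show ?case using Suc by simp
  qed simp
  have "F (xi N y) - F (xi N x) = (\<Sum>k<N. D k)"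
    unfolding D_def by (subst sum_lessThan_telescope) (simp add: pair_0[OF xy] pair_N)
  also have "\<dots> = (\<Sum>k<N. \<rho> ^ k) * D 0" unfolding sum_distrib_right by (intro sum.cong refl D) auto
  finally have eq: "F (xi N y) - F (xi N x) = (\<Sum>k<N. \<rho> ^ k) * D 0" .
  have "(\<Sum>k<N. \<rho> ^ k) \<ge> (\<Sum>k\<in>{0}. \<rho> ^ k)"
    using N pos by (intro sum_mono2) (auto simp: \<rho>_def)
  then have "(\<Sum>k<N. \<rho> ^ k) > 0" by simp
  then show ?thesis
    unfolding ruin_rate_def \<rho>_def[symmetric] eq by (simp add: D_def pair_0[OF xy])
qed (simp add: ruin_rate_def)

text \<open>For positive \<open>r x y\<close> the geometric series converges exactly when
  \<open>r y x < r x y\<close>; otherwise its first \<open>N\<close> terms sum to at least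
  \<open>N\<close>. This dichotomy is the indicator in \<open>brates\<close>.\<close>

lemma ruin_rate_tendsto:
  assumes r: "rates r"
  shows "(\<lambda>N. ruin_rate r N x y) \<longlonglongrightarrow> brates r x y"
proof (cases "r x y = 0")
  case True
  moreover have "r y x \<ge> 0" using r by (simp add: rates_def)
  ultimately show ?thesis by (simp add: ruin_rate_def brates_def)
next
  case False
  define \<rho> where "\<rho> = r y x / r x y"
  have pos: "r x y > 0" "r y x \<ge> 0" using r False by (auto simp: rates_def less_le)
  have \<rho>: "\<rho> \<ge> 0" using pos by (simp add: \<rho>_def)
  show ?thesis
  proof (cases "r x y > r y x")
    case True
    then have \<rho>1: "\<rho> < 1" using pos by (simp add: \<rho>_def)
    have "(\<lambda>N. \<Sum>k<N. \<rho> ^ k) \<longlonglongrightarrow> 1 / (1 - \<rho>)"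
      using geometric_sums[of \<rho>] \<rho> \<rho>1 by (simp add: sums_def)
    then have "(\<lambda>N. r x y / (\<Sum>k<N. \<rho> ^ k)) \<longlonglongrightarrow> r x y / (1 / (1 - \<rho>))"
      using \<rho>1 by (intro tendsto_intros) auto
    moreover have "r x y / (1 / (1 - \<rho>)) = brates r x y"
      using True pos by (simp add: brates_def \<rho>_def field_simps)
    ultimately show ?thesis by (simp add: ruin_rate_def \<rho>_def)
  next
    case nl: False
    then have \<rho>1: "\<rho> \<ge> 1" using pos by (simp add: \<rho>_def)
    have "real N \<le> (\<Sum>k<N. \<rho> ^ k)" for N
      using sum_mono[of "{..<N}" "\<lambda>_. 1" "\<lambda>k. \<rho> ^ k"] one_le_power[OF \<rho>1] by simp
    then have "filterlim (\<lambda>N. \<Sum>k<N. \<rho> ^ k) at_top sequentially"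
      by (intro filterlim_at_top_mono[OF filterlim_real_sequentially]) auto
    then have "(\<lambda>N. r x y / (\<Sum>k<N. \<rho> ^ k)) \<longlonglongrightarrow> 0"
      by (intro tendsto_divide_0[OF tendsto_const] filterlim_at_top_imp_at_infinity)
    then show ?thesis using nl by (simp add: ruin_rate_def \<rho>_def brates_def)
  qed
qed

text \<open>At \<open>xi N x\<close> only the \<open>d\<close>-term acts: it puts one particle on a
  site \<open>y\<close>, and gambler's ruin decides whether the condensate follows.\<close>

lemma gen_harmonic_xi:
  assumes r: "rates r" and N: "N > 0"
    and harm: "\<And>\<eta>. \<eta> \<in> configs N \<Longrightarrow> gen r 0 F \<eta> = 0"
  shows "gen r d F (xi N x) =
    d * real N * (\<Sum>y\<in>UNIV. ruin_rate r N x y * (F (xi N y) - F (xi N x)))"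
proof -
  have "gen r d F (xi N x) =
    d * (\<Sum>a\<in>UNIV. \<Sum>y\<in>UNIV - {a}. real (xi N x a) * r a y * (F (move a y (xi N x)) - F (xi N x)))"
    using gen_split[of r d F "xi N x"] by (simp add: gen0_xi)
  also have "(\<Sum>a\<in>UNIV. \<Sum>y\<in>UNIV - {a}. real (xi N x a) * r a y * (F (move a y (xi N x)) - F (xi N x)))
    = (\<Sum>a\<in>{x}. \<Sum>y\<in>UNIV - {a}. real (xi N x a) * r a y * (F (move a y (xi N x)) - F (xi N x)))"
    by (rule sum.mono_neutral_right) (auto simp: xi_def)
  also have "\<dots> = (\<Sum>y\<in>UNIV - {x}. real N * (ruin_rate r N x y * (F (xi N y) - F (xi N x))))"
    by (auto intro!: sum.cong simp: move_xi[OF _ N] gambler_ruin[OF r N _ harm, symmetric]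
        simp del: One_nat_def) (simp add: xi_def)
  also have "\<dots> = real N * (\<Sum>y\<in>UNIV. ruin_rate r N x y * (F (xi N y) - F (xi N x)))"
    by (simp add: sum_distrib_left sum_diff1)
  finally show ?thesis by simp
qed

section \<open>Limits of the condensate position\<close>

locale condensing_inclusion =
  fixes r :: "'a::finite \<Rightarrow> 'a \<Rightarrow> real" and d :: "nat \<Rightarrow> real"
    and \<mu> :: "nat \<Rightarrow> ('a \<Rightarrow> nat) \<Rightarrow> real"
  assumes rates: "rates r" and d_pos: "\<And>N. d N > 0"
    and inv: "\<And>N. inv_prob_IP r (d N) N (\<mu> N)" and cond: "condensation \<mu>"
begin

definition E :: "nat \<Rightarrow> (('a \<Rightarrow> nat) \<Rightarrow> real) \<Rightarrow> real" where
  "E N g = (\<Sum>\<eta>\<in>configs N. \<mu> N \<eta> * g \<eta>)"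

definition p :: "nat \<Rightarrow> 'a \<Rightarrow> real" where
  "p N x = \<mu> N (xi N x)"

definition R :: real where
  "R = (\<Sum>x\<in>UNIV. \<Sum>y\<in>UNIV. r x y)"

lemma r_nonneg: "r x y \<ge> 0" and r_diag: "r x x = 0"
  using rates by (auto simp: rates_def)

lemma R_nonneg: "R \<ge> 0"
  unfolding R_def by (intro sum_nonneg r_nonneg)

lemma mu_nonneg: "\<mu> N \<eta> \<ge> 0"
  using inv[of N] by (cases "\<eta> \<in> configs N") (auto simp: inv_prob_IP_def)

lemma E_gen: "E N (gen r (d N) F) = 0"
  using inv[of N] by (simp add: inv_prob_IP_def E_def)

lemma E_const: "E N (\<lambda>_. c) = c"
  using inv[of N] by (simp add: inv_prob_IP_def E_def sum_distrib_right[symmetric])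

lemma E_add: "E N (\<lambda>\<eta>. F \<eta> + G \<eta>) = E N F + E N G"
  by (simp add: E_def distrib_left sum.distrib)

lemma E_diff: "E N (\<lambda>\<eta>. F \<eta> - G \<eta>) = E N F - E N G"
  by (simp add: E_def right_diff_distrib sum_subtractf)

lemma E_uminus: "E N (\<lambda>\<eta>. - F \<eta>) = - E N F"
  by (simp add: E_def sum_negf)

lemma E_cmult: "E N (\<lambda>\<eta>. c * F \<eta>) = c * E N F"
  by (simp add: E_def sum_distrib_left mult.left_commute)

lemma E_divide: "E N (\<lambda>\<eta>. F \<eta> / c) = E N F / c"
  by (simp add: E_def sum_divide_distrib)

lemma E_sum: "E N (\<lambda>\<eta>. \<Sum>i\<in>I. F i \<eta>) = (\<Sum>i\<in>I. E N (F i))"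
  unfolding E_def sum_distrib_left by (rule sum.swap)

lemma E_cong: "(\<And>\<eta>. \<eta> \<in> configs N \<Longrightarrow> F \<eta> = G \<eta>) \<Longrightarrow> E N F = E N G"
  by (simp add: E_def)

lemma E_mono: "(\<And>\<eta>. \<eta> \<in> configs N \<Longrightarrow> F \<eta> \<le> G \<eta>) \<Longrightarrow> E N F \<le> E N G"
  unfolding E_def by (intro sum_mono mult_left_mono mu_nonneg)

lemma E_nonneg: "(\<And>\<eta>. \<eta> \<in> configs N \<Longrightarrow> F \<eta> \<ge> 0) \<Longrightarrow> E N F \<ge> 0"
  using E_mono[of N "\<lambda>_. 0" F] by (simp add: E_const)

lemma p_nonneg: "p N x \<ge> 0"
  by (simp add: p_def mu_nonneg)

lemma p_le_1: "p N x \<le> 1"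
proof -
  have "p N x \<le> (\<Sum>\<eta>\<in>configs N. \<mu> N \<eta>)"
    unfolding p_def by (intro member_le_sum xi_in_configs mu_nonneg finite_configs)
  then show ?thesis using inv[of N] by (simp add: inv_prob_IP_def)
qed

lemma p_mult_null:
  assumes "X \<longlonglongrightarrow> 0"
  shows "(\<lambda>N. p N x * X N) \<longlonglongrightarrow> 0"
proof (rule Lim_null_comparison[OF always_eventually tendsto_rabs_zero[OF assms]], rule allI)
  show "norm (p N x * X N) \<le> \<bar>X N\<bar>" for N
    using p_nonneg[of N x] p_le_1[of N x] by (simp add: abs_mult mult_left_le_one_le)
qed

lemma sum_p: "(\<lambda>N. \<Sum>x\<in>UNIV. p N x) \<longlonglongrightarrow> 1"
  using cond by (simp add: condensation_def p_def)

text \<open>The error is at most \<open>C\<close> times the mass of the non-condensed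
  configurations. \<open>C\<close> must be uniform in \<open>N\<close>, since nothing is known about
  how fast that mass vanishes.\<close>

lemma E_concentrates:
  assumes bd: "\<And>N \<eta>. N > 0 \<Longrightarrow> \<eta> \<in> configs N \<Longrightarrow> \<bar>g N \<eta>\<bar> \<le> C"
  shows "(\<lambda>N. E N (g N) - (\<Sum>x\<in>UNIV. p N x * g N (xi N x))) \<longlonglongrightarrow> 0"
proof (rule Lim_null_comparison)
  have "(\<lambda>N. C * (1 - (\<Sum>x\<in>UNIV. p N x))) \<longlonglongrightarrow> C * (1 - 1)"
    by (intro tendsto_intros sum_p)
  then show "(\<lambda>N. C * (1 - (\<Sum>x\<in>UNIV. p N x))) \<longlonglongrightarrow> 0" by simp
  show "\<forall>\<^sub>F N in sequentially. norm (E N (g N) - (\<Sum>x\<in>UNIV. p N x * g N (xi N x)))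
          \<le> C * (1 - (\<Sum>x\<in>UNIV. p N x))"
    using eventually_gt_at_top[of 0]
  proof eventually_elim
    case (elim N)
    have split: "E N h = (\<Sum>x\<in>UNIV. p N x * h (xi N x)) + (\<Sum>\<eta>\<in>configs N - range (xi N). \<mu> N \<eta> * h \<eta>)"
      for h
    proof -
      have "E N h = (\<Sum>\<eta>\<in>configs N - range (xi N). \<mu> N \<eta> * h \<eta>) + (\<Sum>\<eta>\<in>range (xi N). \<mu> N \<eta> * h \<eta>)"
        unfolding E_def using xi_in_configs by (intro sum.subset_diff finite_configs) auto
      also have "(\<Sum>\<eta>\<in>range (xi N). \<mu> N \<eta> * h \<eta>) = (\<Sum>x\<in>UNIV. p N x * h (xi N x))"
        by (simp add: sum.reindex[OF inj_xi[OF elim]] p_def)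
      finally show ?thesis by simp
    qed
    have "norm (E N (g N) - (\<Sum>x\<in>UNIV. p N x * g N (xi N x)))
        = \<bar>\<Sum>\<eta>\<in>configs N - range (xi N). \<mu> N \<eta> * g N \<eta>\<bar>"
      using split[of "g N"] by simp
    also have "\<dots> \<le> (\<Sum>\<eta>\<in>configs N - range (xi N). \<bar>\<mu> N \<eta> * g N \<eta>\<bar>)" by (rule sum_abs)
    also have "\<dots> \<le> (\<Sum>\<eta>\<in>configs N - range (xi N). \<mu> N \<eta> * C)"
      using bd[OF elim] mu_nonneg by (intro sum_mono) (auto simp: abs_mult intro!: mult_left_mono)
    also have "\<dots> = C * (1 - (\<Sum>x\<in>UNIV. p N x))"
      using split[of "\<lambda>_. C"] unfolding E_const sum_distrib_right[symmetric] by (simp add: algebra_simps)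
    finally show ?case .
  qed
qed

lemma p_flux_tendsto_0:
  assumes f: "\<And>x. 0 \<le> f x" "\<And>x. f x \<le> M"
  shows "(\<lambda>N. \<Sum>x\<in>UNIV. p N x * (\<Sum>y\<in>UNIV. brates r x y * (f y - f x))) \<longlonglongrightarrow> 0"
proof -
  have "\<exists>F. N > 0 \<longrightarrow> (\<forall>\<eta>\<in>configs N. 0 \<le> F \<eta> \<and> F \<eta> \<le> M) \<and>
      (\<forall>\<eta>\<in>configs N. gen r 0 F \<eta> = 0) \<and> (\<forall>x. F (xi N x) = f x)" for N
  proof (cases "N > 0")
    case True
    show ?thesis by (rule harmonic_extension[OF rates True, of f M, OF f]) blast
  qed auto
  then obtain F where "\<And>N. N > 0 \<longrightarrow> (\<forall>\<eta>\<in>configs N. 0 \<le> F N \<eta> \<and> F N \<eta> \<le> M) \<and>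
      (\<forall>\<eta>\<in>configs N. gen r 0 (F N) \<eta> = 0) \<and> (\<forall>x. F N (xi N x) = f x)"
    by metis
  then have F: "\<And>N \<eta>. N > 0 \<Longrightarrow> \<eta> \<in> configs N \<Longrightarrow> 0 \<le> F N \<eta> \<and> F N \<eta> \<le> M"
    and harm: "\<And>N \<eta>. N > 0 \<Longrightarrow> \<eta> \<in> configs N \<Longrightarrow> gen r 0 (F N) \<eta> = 0"
    and F_xi: "\<And>N x. N > 0 \<Longrightarrow> F N (xi N x) = f x"
    by blast+
  \<comment> \<open>Harmonicity leaves only the \<open>d\<close>-part, which is at most
    \<open>d N * real N * (R * M)\<close>; this normalisation makes it bounded.\<close>
  define g where "g N \<eta> = gen r (d N) (F N) \<eta> / (d N * real N)" for N \<eta>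
  have "(\<lambda>N. E N (g N) - (\<Sum>x\<in>UNIV. p N x * g N (xi N x))) \<longlonglongrightarrow> 0"
  proof (rule E_concentrates)
    fix N :: nat and \<eta> :: "'a \<Rightarrow> nat" assume N: "N > 0" and \<eta>: "\<eta> \<in> configs N"
    have "\<bar>\<Sum>x\<in>UNIV. \<Sum>y\<in>UNIV - {x}. real (\<eta> x) * r x y * (F N (move x y \<eta>) - F N \<eta>)\<bar>
       \<le> (\<Sum>x\<in>UNIV. \<Sum>y\<in>UNIV - {x}. real N * r x y * M)"
    proof (intro order.trans[OF sum_abs] sum_mono)
      fix x y
      have "\<bar>F N (move x y \<eta>) - F N \<eta>\<bar> \<le> M"
        using F[OF N \<eta>] F[OF N move_in_configs[OF \<eta>], of x y] by auto
      then show "\<bar>real (\<eta> x) * r x y * (F N (move x y \<eta>) - F N \<eta>)\<bar> \<le> real N * r x y * M"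
        using configs_le[OF \<eta>, of x] r_nonneg[of x y] unfolding abs_mult
        by (intro mult_mono) auto
    qed
    also have "\<dots> = real N * (R * M)"
      by (simp add: R_def sum_distrib_left sum_distrib_right sum_diff1 r_diag mult.assoc)
    finally show "\<bar>g N \<eta>\<bar> \<le> R * M"
      using d_pos[of N] N harm[OF N \<eta>] unfolding g_def
      by (subst gen_split) (simp add: abs_mult divide_le_eq mult.commute)
  qed
  moreover have "\<forall>\<^sub>F N in sequentially. E N (g N) - (\<Sum>x\<in>UNIV. p N x * g N (xi N x))
      = - (\<Sum>x\<in>UNIV. p N x * (\<Sum>y\<in>UNIV. ruin_rate r N x y * (f y - f x)))"
    using eventually_gt_at_top[of 0]
  proof eventually_elim
    case (elim N)
    have "g N (xi N x) = (\<Sum>y\<in>UNIV. ruin_rate r N x y * (f y - f x))" for x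
      using gen_harmonic_xi[OF rates elim harm[OF elim], of "d N" x] d_pos[of N] elim
      by (simp add: g_def F_xi)
    moreover have "E N (g N) = 0" unfolding g_def by (simp add: E_divide E_gen)
    ultimately show ?case by simp
  qed
  ultimately have "(\<lambda>N. - (\<Sum>x\<in>UNIV. p N x * (\<Sum>y\<in>UNIV. ruin_rate r N x y * (f y - f x)))) \<longlonglongrightarrow> 0"
    by (rule Lim_transform_eventually)
  from tendsto_minus[OF this] have main: "(\<lambda>N. \<Sum>x\<in>UNIV. p N x * (\<Sum>y\<in>UNIV. ruin_rate r N x y * (f y - f x))) \<longlonglongrightarrow> 0"
    by simp
  \<comment> \<open>As \<open>p\<close> is bounded, replacing \<open>ruin_rate\<close> by its limit
    costs only a null sequence.\<close>
  have "(\<lambda>N. \<Sum>y\<in>UNIV. (ruin_rate r N x y - brates r x y) * (f y - f x))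
      \<longlonglongrightarrow> (\<Sum>y\<in>UNIV. (brates r x y - brates r x y) * (f y - f x))" for x
    by (intro tendsto_intros ruin_rate_tendsto rates)
  then have "(\<lambda>N. \<Sum>y\<in>UNIV. (ruin_rate r N x y - brates r x y) * (f y - f x)) \<longlonglongrightarrow> 0" for x
    by simp
  then have "(\<lambda>N. \<Sum>x\<in>UNIV. p N x * (\<Sum>y\<in>UNIV. (ruin_rate r N x y - brates r x y) * (f y - f x))) \<longlonglongrightarrow> 0"
    by (rule tendsto_null_sum[OF p_mult_null])
  from tendsto_diff[OF main this] show ?thesis
    by (simp add: sum_subtractf[symmetric] right_diff_distrib[symmetric] left_diff_distrib[symmetric])
qed

lemma subseq_limit_stationary:
  assumes s: "strict_mono s" and lim: "\<And>x. (\<lambda>k. p (s k) x) \<longlonglongrightarrow> q x"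
  shows "stationary (brates r) q"
  unfolding stationary_def
proof
  fix C
  define f where "f x = (of_bool (x \<in> C) :: real)" for x :: 'a
  have "(\<lambda>N. \<Sum>x\<in>UNIV. p N x * (\<Sum>y\<in>UNIV. brates r x y * (f y - f x))) \<longlonglongrightarrow> 0"
    by (rule p_flux_tendsto_0[of f 1]) (auto simp: f_def)
  from LIMSEQ_subseq_LIMSEQ[OF this s]
  have "(\<lambda>k. \<Sum>x\<in>UNIV. p (s k) x * (\<Sum>y\<in>UNIV. brates r x y * (f y - f x))) \<longlonglongrightarrow> 0"
    by (simp add: o_def)
  moreover have "(\<lambda>k. \<Sum>x\<in>UNIV. p (s k) x * (\<Sum>y\<in>UNIV. brates r x y * (f y - f x)))
      \<longlonglongrightarrow> (\<Sum>x\<in>UNIV. q x * (\<Sum>y\<in>UNIV. brates r x y * (f y - f x)))"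
    by (intro tendsto_intros lim)
  ultimately show "(\<Sum>x\<in>UNIV. q x * (\<Sum>y\<in>UNIV. brates r x y * (of_bool (y \<in> C) - of_bool (x \<in> C)))) = 0"
    using LIMSEQ_unique unfolding f_def by blast
qed

lemma subseq_limit_prob:
  assumes s: "strict_mono s" and lim: "\<And>x. (\<lambda>k. p (s k) x) \<longlonglongrightarrow> q x"
  shows "q x \<ge> 0" and "sum q UNIV = 1"
proof -
  show "q x \<ge> 0" using lim[of x] p_nonneg by (auto intro: LIMSEQ_le_const)
  have "(\<lambda>k. \<Sum>x\<in>UNIV. p (s k) x) \<longlonglongrightarrow> 1"
    using LIMSEQ_subseq_LIMSEQ[OF sum_p s] by (simp add: o_def)
  moreover have "(\<lambda>k. \<Sum>x\<in>UNIV. p (s k) x) \<longlonglongrightarrow> sum q UNIV" by (intro tendsto_intros lim)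
  ultimately show "sum q UNIV = 1" using LIMSEQ_unique by blast
qed

lemma brates_nonneg: "brates r x y \<ge> 0"
  by (simp add: brates_def)

lemma subseq_limit_inv_prob_on_S0:
  assumes "strict_mono s" and "\<And>x. (\<lambda>k. p (s k) x) \<longlonglongrightarrow> q x"
  shows "inv_prob_on (S0 r) (brates r) q"
  unfolding S0_def using assms
  by (intro stationary_inv_prob_on_recurrent brates_nonneg subseq_limit_stationary subseq_limit_prob) auto

lemma p_transient_tendsto_0:
  assumes "y \<notin> S0 r"
  shows "(\<lambda>N. p N y) \<longlonglongrightarrow> 0"
proof (rule tendsto_if_subseq_limits)
  show "\<bar>p N x\<bar> \<le> 1" for N x using p_nonneg p_le_1 by auto
  show "q y = 0" if "strict_mono s" "\<And>x. (\<lambda>k. p (s k) x) \<longlonglongrightarrow> q x" for s q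
    using subseq_limit_inv_prob_on_S0[OF that] assms by (simp add: inv_prob_on_def)
qed

end

section \<open>Polynomial test functions\<close>

definition dens :: "nat \<Rightarrow> ('a \<Rightarrow> nat) \<Rightarrow> 'a \<Rightarrow> real" where
  "dens N \<eta> x = real (\<eta> x) / real N"

definition dens_avg :: "nat \<Rightarrow> ('a::finite \<Rightarrow> real) \<Rightarrow> ('a \<Rightarrow> nat) \<Rightarrow> real" where
  "dens_avg N f \<eta> = (\<Sum>z\<in>UNIV. f z * dens N \<eta> z)"

definition incr :: "('a \<Rightarrow> real) \<Rightarrow> 'a \<Rightarrow> 'a \<Rightarrow> real" where
  "incr f a b = f b - f a"

lemma dens_nonneg: "dens N \<eta> x \<ge> 0"
  by (simp add: dens_def)

lemma dens_le_1: "\<eta> \<in> configs N \<Longrightarrow> dens N \<eta> x \<le> 1"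
  using configs_le[of \<eta> N x] by (cases "N = 0") (auto simp: dens_def divide_le_eq)

lemma sum_dens:
  assumes "N > 0" "\<eta> \<in> configs N"
  shows "(\<Sum>x\<in>UNIV. dens N \<eta> x) = 1"
proof -
  have "real (\<Sum>x\<in>UNIV. \<eta> x) = real N" using assms(2) by (simp add: configs_def)
  then show ?thesis
    using assms(1) by (simp add: dens_def sum_divide_distrib[symmetric])
qed

lemma dens_xi: "N > 0 \<Longrightarrow> dens N (xi N x) y = of_bool (y = x)"
  by (simp add: dens_def xi_def)

lemma dens_avg_xi: "N > 0 \<Longrightarrow> dens_avg N f (xi N x) = f x"
  by (simp add: dens_avg_def dens_xi)

lemma dens_avg_move:
  fixes \<eta> :: "'a::finite \<Rightarrow> nat"
  assumes "N > 0" "\<eta> a \<ge> 1"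
  shows "dens_avg N f (move a b \<eta>) = dens_avg N f \<eta> + incr f a b / real N"
proof -
  have *: "dens_avg N f \<zeta> = (\<Sum>z\<in>UNIV. f z * real (\<zeta> z)) / real N" for \<zeta> :: "'a \<Rightarrow> nat"
    by (simp add: dens_avg_def dens_def sum_divide_distrib)
  show ?thesis
    unfolding * using sum_mult_move[of \<eta> a f b] assms by (simp add: incr_def add_divide_distrib)
qed

lemma dens_avg_bound:
  assumes "N > 0" "\<eta> \<in> configs N" "\<And>x. \<bar>f x\<bar> \<le> 1"
  shows "\<bar>dens_avg N f \<eta>\<bar> \<le> 1"
proof -
  have "\<bar>dens_avg N f \<eta>\<bar> \<le> (\<Sum>z\<in>UNIV. \<bar>f z * dens N \<eta> z\<bar>)"
    unfolding dens_avg_def by (rule sum_abs)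
  also have "\<dots> \<le> (\<Sum>z\<in>UNIV. dens N \<eta> z)"
    using assms(3) by (intro sum_mono) (simp add: abs_mult dens_nonneg mult_left_le_one_le)
  finally show ?thesis using sum_dens[OF assms(1,2)] by simp
qed

lemma incr_bound:
  assumes "\<And>x. \<bar>f x\<bar> \<le> 1"
  shows "\<bar>incr f a b\<bar> \<le> 2"
  using assms[of a] assms[of b] unfolding incr_def by linarith

lemma dens_avg_const: "N > 0 \<Longrightarrow> \<eta> \<in> configs N \<Longrightarrow> dens_avg N (\<lambda>_. 1) \<eta> = 1"
  by (simp add: dens_avg_def sum_dens)

definition ind :: "'a \<Rightarrow> 'a \<Rightarrow> real" where
  "ind x z = of_bool (z = x)"

lemma ind_bound: "\<bar>ind x z\<bar> \<le> 1"
  by (simp add: ind_def)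

lemma dens_avg_ind: "dens_avg N (ind x) \<eta> = dens N \<eta> x"
  by (simp add: dens_avg_def ind_def)

lemma sum_sum_of_bool:
  fixes w :: "'a::finite \<Rightarrow> 'a \<Rightarrow> real"
  shows "(\<Sum>a\<in>UNIV. \<Sum>b\<in>UNIV. w a b * (of_bool (a = x) * of_bool (b = y))) = w x y"
proof -
  have "(\<Sum>b\<in>UNIV. w a b * (of_bool (a = x) * of_bool (b = y))) = w a y * of_bool (a = x)" for a
    by (cases "a = x") simp_all
  then show ?thesis by simp
qed

context condensing_inclusion
begin

text \<open>Products of the densities of two sites that exchange particles with a bias have expectation of
  order d/N, hence the scaling by N/d.\<close>
definition B :: "nat \<Rightarrow> (('a \<Rightarrow> nat) \<Rightarrow> real) \<Rightarrow> real" where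
  "B N g = real N / d N * E N g"

text \<open>With \<open>w\<close> equal to \<open>N\<close> times the increments of a function,
  \<open>real N * pair_sum N w\<close> is the generator without the \<open>d\<close>-term applied to
  that function.\<close>

definition pair_sum :: "nat \<Rightarrow> ('a \<Rightarrow> 'a \<Rightarrow> real) \<Rightarrow> ('a \<Rightarrow> nat) \<Rightarrow> real" where
  "pair_sum N w \<eta> = (\<Sum>a\<in>UNIV. \<Sum>b\<in>UNIV. dens N \<eta> a * dens N \<eta> b * r a b * w a b)"

lemma B_add: "B N (\<lambda>\<eta>. F \<eta> + G \<eta>) = B N F + B N G"
  by (simp add: B_def E_add distrib_left)

lemma B_diff: "B N (\<lambda>\<eta>. F \<eta> - G \<eta>) = B N F - B N G"
  by (simp add: B_def E_diff right_diff_distrib)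

lemma B_uminus: "B N (\<lambda>\<eta>. - F \<eta>) = - B N F"
  by (simp add: B_def E_uminus)

lemma B_cmult: "B N (\<lambda>\<eta>. c * F \<eta>) = c * B N F"
  by (simp add: B_def E_cmult)

lemma B_divide: "B N (\<lambda>\<eta>. F \<eta> / c) = B N F / c"
  by (simp add: B_def E_divide)

lemma B_sum: "B N (\<lambda>\<eta>. \<Sum>i\<in>I. F i \<eta>) = (\<Sum>i\<in>I. B N (F i))"
  by (simp add: B_def E_sum sum_distrib_left)

lemma B_cong: "(\<And>\<eta>. \<eta> \<in> configs N \<Longrightarrow> F \<eta> = G \<eta>) \<Longrightarrow> B N F = B N G"
  by (simp add: B_def cong: E_cong)

lemma B_mono: "(\<And>\<eta>. \<eta> \<in> configs N \<Longrightarrow> F \<eta> \<le> G \<eta>) \<Longrightarrow> B N F \<le> B N G"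
  unfolding B_def using d_pos[of N] by (intro mult_left_mono E_mono) auto

lemma B_nonneg: "(\<And>\<eta>. \<eta> \<in> configs N \<Longrightarrow> F \<eta> \<ge> 0) \<Longrightarrow> B N F \<ge> 0"
  unfolding B_def using d_pos[of N] by (intro mult_nonneg_nonneg E_nonneg) auto

text \<open>The weight \<open>real N / d N\<close> may be large, so smallness of \<open>g\<close> is
  not enough: it has to be dominated by something already known to vanish under
  \<open>B\<close>.\<close>

lemma B_squeeze:
  assumes bd: "\<And>N \<eta>. N > 0 \<Longrightarrow> \<eta> \<in> configs N \<Longrightarrow> \<bar>g N \<eta>\<bar> \<le> C * h N \<eta>"
    and lim: "(\<lambda>N. B N (h N)) \<longlonglongrightarrow> 0"
  shows "(\<lambda>N. B N (g N)) \<longlonglongrightarrow> 0"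
proof (rule Lim_null_comparison)
  show "(\<lambda>N. C * B N (h N)) \<longlonglongrightarrow> 0" using tendsto_mult_right_zero[OF lim] by simp
  show "\<forall>\<^sub>F N in sequentially. norm (B N (g N)) \<le> C * B N (h N)"
    using eventually_gt_at_top[of 0]
  proof eventually_elim
    case (elim N)
    have "B N (g N) \<le> B N (\<lambda>\<eta>. C * h N \<eta>)" "B N (\<lambda>\<eta>. - g N \<eta>) \<le> B N (\<lambda>\<eta>. C * h N \<eta>)"
      using bd[OF elim] by (force intro!: B_mono)+
    then show ?case by (simp add: B_uminus B_cmult)
  qed
qed

text \<open>The invariance identity divided by \<open>d N\<close>. \<open>D\<close> is prescribed
  only for \<open>\<eta> a \<ge> 1\<close>: at an empty site \<open>move\<close> is the identity, so
  the increment formula may fail there, but the weight \<open>dens N \<eta> a\<close> is then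
  zero.\<close>

lemma balance_rescaled:
  assumes N: "N > 0"
    and D: "\<And>\<eta> a b. \<eta> \<in> configs N \<Longrightarrow> \<eta> a \<ge> 1 \<Longrightarrow> D \<eta> a b = real N * (F (move a b \<eta>) - F \<eta>)"
  shows "B N (\<lambda>\<eta>. pair_sum N (D \<eta>) \<eta>) + E N (\<lambda>\<eta>. \<Sum>a\<in>UNIV. \<Sum>b\<in>UNIV. dens N \<eta> a * r a b * D \<eta> a b) = 0"
proof -
  have "gen r (d N) F \<eta> = real N * pair_sum N (D \<eta>) \<eta>
      + d N * (\<Sum>a\<in>UNIV. \<Sum>b\<in>UNIV. dens N \<eta> a * r a b * D \<eta> a b)" if \<eta>: "\<eta> \<in> configs N" for \<eta>
  proof -
    have rate_split: "real (\<eta> a) * (d N + real (\<eta> b)) * r a b * (F (move a b \<eta>) - F \<eta>)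
      = real N * (dens N \<eta> a * dens N \<eta> b * r a b * D \<eta> a b)
        + d N * (dens N \<eta> a * r a b * D \<eta> a b)" for a b
    proof (cases "\<eta> a \<ge> 1")
      case True
      show ?thesis unfolding D[OF \<eta> True] dens_def using N by (simp add: field_simps)
    next
      case False
      then have "\<eta> a = 0" by simp
      then show ?thesis by (simp add: dens_def)
    qed
    have "gen r (d N) F \<eta> = (\<Sum>a\<in>UNIV. \<Sum>b\<in>UNIV. real (\<eta> a) * (d N + real (\<eta> b)) * r a b * (F (move a b \<eta>) - F \<eta>))"
      by (simp add: gen_def sum_diff1 r_diag)
    then show ?thesis unfolding rate_split by (simp add: sum.distrib sum_distrib_left pair_sum_def)
  qed
  then have "E N (gen r (d N) F) = E N (\<lambda>\<eta>. real N * pair_sum N (D \<eta>) \<eta>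
      + d N * (\<Sum>a\<in>UNIV. \<Sum>b\<in>UNIV. dens N \<eta> a * r a b * D \<eta> a b))"
    by (rule E_cong)
  then have "real N * E N (\<lambda>\<eta>. pair_sum N (D \<eta>) \<eta>)
      + d N * E N (\<lambda>\<eta>. \<Sum>a\<in>UNIV. \<Sum>b\<in>UNIV. dens N \<eta> a * r a b * D \<eta> a b) = 0"
    unfolding E_gen E_add E_cmult by simp
  then show ?thesis using d_pos[of N] by (simp add: B_def field_simps)
qed

lemma pair_sum_add: "pair_sum N (\<lambda>a b. w a b + w' a b) \<eta> = pair_sum N w \<eta> + pair_sum N w' \<eta>"
  by (simp add: pair_sum_def distrib_left sum.distrib)

lemma pair_sum_cmult: "pair_sum N (\<lambda>a b. c * w a b) \<eta> = c * pair_sum N w \<eta>"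
  by (simp add: pair_sum_def sum_distrib_left mult.left_commute)

lemma pair_sum_divide: "pair_sum N (\<lambda>a b. w a b / c) \<eta> = pair_sum N w \<eta> / c"
  by (simp add: pair_sum_def sum_divide_distrib)

section \<open>Balance relations for products of densities\<close>

text \<open>Invariance tested on a product of three averages. The part with \<open>d\<close> is
  bounded and reduces to the condensed configurations, leaving the sum over \<open>z\<close>; the
  part without \<open>d\<close> stays in full under \<open>B\<close>.\<close>

lemma cubic_balance:
  assumes f: "\<And>x. \<bar>f x\<bar> \<le> 1" and g: "\<And>x. \<bar>g x\<bar> \<le> 1" and h: "\<And>x. \<bar>h x\<bar> \<le> 1"
  shows "(\<lambda>N. B N (\<lambda>\<eta>.
        dens_avg N f \<eta> * dens_avg N g \<eta> * pair_sum N (incr h) \<eta>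
      + dens_avg N f \<eta> * dens_avg N h \<eta> * pair_sum N (incr g) \<eta>
      + dens_avg N g \<eta> * dens_avg N h \<eta> * pair_sum N (incr f) \<eta>
      + (dens_avg N f \<eta> * pair_sum N (\<lambda>a b. incr g a b * incr h a b) \<eta>
         + dens_avg N g \<eta> * pair_sum N (\<lambda>a b. incr f a b * incr h a b) \<eta>
         + dens_avg N h \<eta> * pair_sum N (\<lambda>a b. incr f a b * incr g a b) \<eta>) / real N
      + pair_sum N (\<lambda>a b. incr f a b * incr g a b * incr h a b) \<eta> / (real N)\<^sup>2)
    + (\<Sum>z\<in>UNIV. p N z * (\<Sum>b\<in>UNIV. r z b *
        (f z * g z * incr h z b + f z * h z * incr g z b + g z * h z * incr f z b)))) \<longlonglongrightarrow> 0"
    (is "(\<lambda>N. B N (?G N) + ?P N) \<longlonglongrightarrow> 0")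
proof -
  \<comment> \<open>Exact expansion of \<open>N\<close> times the increment of the product. The
    terms in \<open>1 / N\<close> are kept because the weight inside \<open>B\<close> prevents
    discarding them here.\<close>
  define D where "D N \<eta> a b =
      dens_avg N f \<eta> * dens_avg N g \<eta> * incr h a b
    + dens_avg N f \<eta> * dens_avg N h \<eta> * incr g a b
    + dens_avg N g \<eta> * dens_avg N h \<eta> * incr f a b
    + (dens_avg N f \<eta> * (incr g a b * incr h a b)
       + dens_avg N g \<eta> * (incr f a b * incr h a b)
       + dens_avg N h \<eta> * (incr f a b * incr g a b)) / real N
    + incr f a b * incr g a b * incr h a b / (real N)\<^sup>2" for N \<eta> a b
  define Q where "Q N \<eta> = (\<Sum>a\<in>UNIV. \<Sum>b\<in>UNIV. dens N \<eta> a * r a b * D N \<eta> a b)" for N \<eta>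
  have pair_sum_D: "pair_sum N (D N \<eta>) \<eta> = ?G N \<eta>" for N \<eta>
    unfolding D_def pair_sum_add pair_sum_divide pair_sum_cmult by simp
  have bal: "B N (?G N) + E N (Q N) = 0" if N: "N > 0" for N
  proof -
    have "D N \<eta> a b = real N * (dens_avg N f (move a b \<eta>) * dens_avg N g (move a b \<eta>) * dens_avg N h (move a b \<eta>)
        - dens_avg N f \<eta> * dens_avg N g \<eta> * dens_avg N h \<eta>)"
      if "\<eta> \<in> configs N" "\<eta> a \<ge> 1" for \<eta> a b
      unfolding D_def dens_avg_move[OF N, of \<eta> a, OF that(2)] using N by (simp add: field_simps power2_eq_square)
    then have "B N (\<lambda>\<eta>. pair_sum N (D N \<eta>) \<eta>) + E N (\<lambda>\<eta>. \<Sum>a\<in>UNIV. \<Sum>b\<in>UNIV. dens N \<eta> a * r a b * D N \<eta> a b) = 0"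
      by (rule balance_rescaled[OF N])
    then show ?thesis unfolding pair_sum_D Q_def .
  qed
  \<comment> \<open>26 = 3 * 2 + 3 * 4 + 8: averages are at most 1 and increments at most 2 in
    absolute value, and the divisions by \<open>N\<close> do no harm.\<close>
  have D_bd: "\<bar>D N \<eta> a b\<bar> \<le> 26" if N: "N > 0" and \<eta>: "\<eta> \<in> configs N" for N \<eta> a b
  proof -
    note A = dens_avg_bound[OF N \<eta>, of f, OF f] dens_avg_bound[OF N \<eta>, of g, OF g] dens_avg_bound[OF N \<eta>, of h, OF h]
      incr_bound[of f a b, OF f] incr_bound[of g a b, OF g] incr_bound[of h a b, OF h]
    have t1: "\<bar>u * v * w\<bar> \<le> 2" if "\<bar>u\<bar> \<le> 1" "\<bar>v\<bar> \<le> 1" "\<bar>w\<bar> \<le> 2" for u v w :: real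
      using mult_mono[OF mult_mono[OF that(1,2)] that(3)] by (simp add: abs_mult)
    have t2: "\<bar>u * (v * w)\<bar> \<le> 4" if "\<bar>u\<bar> \<le> 1" "\<bar>v\<bar> \<le> 2" "\<bar>w\<bar> \<le> 2" for u v w :: real
      using mult_mono[OF that(1) mult_mono[OF that(2,3)]] by (simp add: abs_mult)
    have t3: "\<bar>u * v * w\<bar> \<le> 8" if "\<bar>u\<bar> \<le> 2" "\<bar>v\<bar> \<le> 2" "\<bar>w\<bar> \<le> 2" for u v w :: real
      using mult_mono[OF mult_mono[OF that(1,2)] that(3)] by (simp add: abs_mult)
    have div: "\<bar>u / c\<bar> \<le> C" if "\<bar>u\<bar> \<le> C" "c \<ge> 1" for u c C :: real
    proof -
      have "\<bar>u / c\<bar> = \<bar>u\<bar> / c" using that by (simp add: abs_divide)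
      also have "\<dots> \<le> \<bar>u\<bar>" using that mult_left_mono[of 1 c "\<bar>u\<bar>"] by (simp add: divide_le_eq)
      finally show ?thesis using that by simp
    qed
    have N1: "real N \<ge> 1" "(real N)\<^sup>2 \<ge> 1" using N by auto
    have "\<bar>dens_avg N f \<eta> * (incr g a b * incr h a b)
       + dens_avg N g \<eta> * (incr f a b * incr h a b)
       + dens_avg N h \<eta> * (incr f a b * incr g a b)\<bar> \<le> 12"
      using t2[OF A(1,5,6)] t2[OF A(2,4,6)] t2[OF A(3,4,5)] by linarith
    from div[OF this N1(1)] div[OF t3[OF A(4,5,6)] N1(2)]
      t1[OF A(1,2,6)] t1[OF A(1,3,5)] t1[OF A(2,3,4)]
    show ?thesis unfolding D_def by linarith
  qed
  have "(\<lambda>N. E N (Q N) - (\<Sum>z\<in>UNIV. p N z * Q N (xi N z))) \<longlonglongrightarrow> 0"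
  proof (rule E_concentrates)
    fix N :: nat and \<eta> :: "'a \<Rightarrow> nat" assume N: "N > 0" and \<eta>: "\<eta> \<in> configs N"
    have "\<bar>Q N \<eta>\<bar> \<le> (\<Sum>a\<in>UNIV. \<Sum>b\<in>UNIV. r a b * 26)"
      unfolding Q_def
    proof (intro order.trans[OF sum_abs] sum_mono)
      fix a b
      have "\<bar>dens N \<eta> a * r a b * D N \<eta> a b\<bar> \<le> 1 * r a b * 26"
        unfolding abs_mult using dens_nonneg[of N \<eta> a] dens_le_1[OF \<eta>] r_nonneg D_bd[OF N \<eta>]
        by (intro mult_mono) auto
      then show "\<bar>dens N \<eta> a * r a b * D N \<eta> a b\<bar> \<le> r a b * 26" by simp
    qed
    then show "\<bar>Q N \<eta>\<bar> \<le> (\<Sum>a\<in>UNIV. \<Sum>b\<in>UNIV. r a b * 26)" .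
  qed
  moreover have "(\<lambda>N. (\<Sum>z\<in>UNIV. p N z * Q N (xi N z)) - ?P N) \<longlonglongrightarrow> 0"
  proof -
    have inv_lim: "(\<lambda>N. c / real N) \<longlonglongrightarrow> 0" "(\<lambda>N. c / (real N)\<^sup>2) \<longlonglongrightarrow> 0" for c
      using lim_const_over_n[of c] tendsto_mult[OF lim_const_over_n[of c] lim_const_over_n[of 1]]
      by (auto simp: power2_eq_square)
    \<comment> \<open>\<open>rem\<close> collects the corrections in \<open>1 / N\<close>. Here they
      vanish in the limit, being weighted by \<open>p\<close> and not by
      \<open>real N / d N\<close>.\<close>
    define rem where "rem z b N = (f z * (incr g z b * incr h z b) + g z * (incr f z b * incr h z b)
       + h z * (incr f z b * incr g z b)) / real N + incr f z b * incr g z b * incr h z b / (real N)\<^sup>2" for z b N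
    have "rem z b \<longlonglongrightarrow> 0 + 0" for z b unfolding rem_def by (intro tendsto_add inv_lim)
    then have "(\<lambda>N. \<Sum>b\<in>UNIV. r z b * rem z b N) \<longlonglongrightarrow> 0" for z
      by (intro tendsto_null_sum tendsto_mult_right_zero) simp
    then have "(\<lambda>N. \<Sum>z\<in>UNIV. p N z * (\<Sum>b\<in>UNIV. r z b * rem z b N)) \<longlonglongrightarrow> 0"
      by (rule tendsto_null_sum[OF p_mult_null])
    moreover have "\<forall>\<^sub>F N in sequentially. (\<Sum>z\<in>UNIV. p N z * (\<Sum>b\<in>UNIV. r z b * rem z b N))
        = (\<Sum>z\<in>UNIV. p N z * Q N (xi N z)) - ?P N"
      using eventually_gt_at_top[of 0]
    proof eventually_elim
      case (elim N)
      have "Q N (xi N z) = (\<Sum>b\<in>UNIV. r z b * D N (xi N z) z b)" for z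
        unfolding Q_def dens_xi[OF elim] by (simp add: sum_distrib_left[symmetric] mult.assoc)
      moreover have "D N (xi N z) z b = (f z * g z * incr h z b + f z * h z * incr g z b + g z * h z * incr f z b)
          + rem z b N" for z b
        unfolding D_def dens_avg_xi[OF elim] rem_def by simp
      ultimately have "Q N (xi N z) = (\<Sum>b\<in>UNIV. r z b *
          (f z * g z * incr h z b + f z * h z * incr g z b + g z * h z * incr f z b))
          + (\<Sum>b\<in>UNIV. r z b * rem z b N)" for z
        by (simp only: distrib_left sum.distrib)
      then show ?case by (simp only: distrib_left sum.distrib)
    qed
    ultimately show ?thesis by (rule Lim_transform_eventually)
  qed
  ultimately have "(\<lambda>N. - ((E N (Q N) - (\<Sum>z\<in>UNIV. p N z * Q N (xi N z)))
      + ((\<Sum>z\<in>UNIV. p N z * Q N (xi N z)) - ?P N))) \<longlonglongrightarrow> - (0 + 0)"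
    by (intro tendsto_intros)
  then have lim: "(\<lambda>N. - E N (Q N) + ?P N) \<longlonglongrightarrow> 0" by simp
  have "- E N (Q N) + ?P N = B N (?G N) + ?P N" if "N > 0" for N
    using bal[OF that] by linarith
  then have "\<forall>\<^sub>F N in sequentially. - E N (Q N) + ?P N = B N (?G N) + ?P N"
    by (intro eventually_mono[OF eventually_gt_at_top[of 0]])
  with lim show ?thesis by (rule Lim_transform_eventually)
qed

text \<open>The constant function 1 has zero increments and, as the densities sum to 1, average 1;
  putting it for one factor lowers the degree. The linear relation arises in the same way.\<close>

lemma quadratic_balance:
  assumes f: "\<And>x. \<bar>f x\<bar> \<le> 1" and g: "\<And>x. \<bar>g x\<bar> \<le> 1"
  shows "(\<lambda>N. B N (\<lambda>\<eta>. dens_avg N f \<eta> * pair_sum N (incr g) \<eta> + dens_avg N g \<eta> * pair_sum N (incr f) \<eta>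
      + pair_sum N (\<lambda>a b. incr f a b * incr g a b) \<eta> / real N)
    + (\<Sum>z\<in>UNIV. p N z * (\<Sum>b\<in>UNIV. r z b * (f z * incr g z b + g z * incr f z b)))) \<longlonglongrightarrow> 0"
proof (rule Lim_transform_eventually[OF cubic_balance[of f g "\<lambda>_. 1"]], goal_cases)
  case 4
  have *: "incr (\<lambda>_. 1) = (\<lambda>a b. 0)" by (simp add: incr_def fun_eq_iff)
  have **: "pair_sum N (\<lambda>a b. 0) \<eta> = 0" for N \<eta> by (simp add: pair_sum_def)
  show ?case
    using eventually_gt_at_top[of 0]
    by eventually_elim (auto simp: * ** dens_avg_const intro!: B_cong)
qed (use f g in auto)

lemma linear_balance:
  assumes f: "\<And>x. \<bar>f x\<bar> \<le> 1"
  shows "(\<lambda>N. B N (\<lambda>\<eta>. pair_sum N (incr f) \<eta>) + (\<Sum>z\<in>UNIV. p N z * (\<Sum>b\<in>UNIV. r z b * incr f z b))) \<longlonglongrightarrow> 0"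
proof (rule Lim_transform_eventually[OF quadratic_balance[of f "\<lambda>_. 1"]], goal_cases)
  case 3
  have *: "incr (\<lambda>_. 1) = (\<lambda>a b. 0)" by (simp add: incr_def fun_eq_iff)
  have **: "pair_sum N (\<lambda>a b. 0) \<eta> = 0" for N \<eta> by (simp add: pair_sum_def)
  show ?case
    using eventually_gt_at_top[of 0]
    by eventually_elim (auto simp: * ** dens_avg_const intro!: B_cong)
qed (use f in auto)

end

section \<open>Symmetric rates on an attracting set\<close>

text \<open>\<open>A\<close> abstracts the set of recurrent states: these three properties are what
  the second-order analysis takes from it, and \<open>p_off\<close> is supplied by
  \<open>p_transient_tendsto_0\<close>.\<close>

locale attracting_condensation = condensing_inclusion +
  fixes A :: "'a set"
  assumes sym: "\<And>x y. x \<in> A \<Longrightarrow> y \<in> A \<Longrightarrow> r x y = r y x"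
    and attr: "attracting r A"
    and p_off: "\<And>y. y \<notin> A \<Longrightarrow> (\<lambda>N. p N y) \<longlonglongrightarrow> 0"
begin

section \<open>Net flows between \<open>A\<close> and its complement\<close>

text \<open>Positive when \<open>x\<close> wins the exchange with \<open>y\<close>. Antisymmetric,
  zero inside \<open>A\<close>, and for \<open>x\<close> in \<open>A\<close> and \<open>y\<close>
  outside it is the pull of \<open>A\<close>.\<close>

definition bias :: "'a \<Rightarrow> 'a \<Rightarrow> real" where
  "bias x y = r y x - r x y"

definition ind_off :: "'a \<Rightarrow> real" where
  "ind_off z = of_bool (z \<notin> A)"

definition off_mass :: "nat \<Rightarrow> ('a \<Rightarrow> nat) \<Rightarrow> real" where
  "off_mass N \<eta> = (\<Sum>y\<in>- A. dens N \<eta> y)"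

text \<open>The net rates at which site y outside A loses particles to A and gains particles from the other
  sites outside A, in the dynamics without the d-term and with the factor N^2 removed.\<close>
definition drain :: "nat \<Rightarrow> 'a \<Rightarrow> ('a \<Rightarrow> nat) \<Rightarrow> real" where
  "drain N y \<eta> = (\<Sum>a\<in>A. bias a y * (dens N \<eta> a * dens N \<eta> y))"

definition off_flux :: "nat \<Rightarrow> 'a \<Rightarrow> ('a \<Rightarrow> nat) \<Rightarrow> real" where
  "off_flux N y \<eta> = (\<Sum>a\<in>- A. bias y a * (dens N \<eta> a * dens N \<eta> y))"

definition drain_total :: "nat \<Rightarrow> ('a \<Rightarrow> nat) \<Rightarrow> real" where
  "drain_total N \<eta> = (\<Sum>y\<in>- A. drain N y \<eta>)"

lemma bias_nonneg: "x \<in> A \<Longrightarrow> y \<notin> A \<Longrightarrow> bias x y \<ge> 0"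
  using attr r_nonneg[of x y] r_nonneg[of y x] unfolding bias_def attracting_def
  by (cases "r x y + r y x > 0") force+

lemma bias_zeroD: "x \<in> A \<Longrightarrow> y \<notin> A \<Longrightarrow> bias x y = 0 \<Longrightarrow> r x y = 0 \<and> r y x = 0"
  using attr r_nonneg[of x y] r_nonneg[of y x] unfolding bias_def attracting_def
  by (cases "r x y + r y x > 0") force+

lemma bias_le_R: "\<bar>bias x y\<bar> \<le> R"
proof -
  have "r x y \<le> R" for x y
  proof -
    have "r x y \<le> (\<Sum>y\<in>UNIV. r x y)" by (intro member_le_sum r_nonneg) auto
    also have "\<dots> \<le> R" unfolding R_def by (rule member_le_sum) (auto intro: sum_nonneg r_nonneg)
    finally show ?thesis .
  qed
  from this[of x y] this[of y x] r_nonneg[of x y] r_nonneg[of y x] show ?thesis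
    unfolding bias_def by linarith
qed

text \<open>Strictness in \<open>attracting\<close> makes \<open>bias x y\<close> positive as soon
  as one of the rates is, and finiteness gives a common constant. Second-order terms involve
  \<open>r x y + r y x\<close> and can thus be bounded by \<open>drain_total\<close>.\<close>

lemma rates_le_bias:
  obtains K where "K \<ge> 0" "\<And>x y. x \<in> A \<Longrightarrow> y \<notin> A \<Longrightarrow> r x y + r y x \<le> K * bias x y"
proof
  define k where "k x y = (r x y + r y x) / bias x y" for x y
  define K where "K = (\<Sum>x\<in>A. \<Sum>y\<in>- A. k x y)"
  have k: "k x y \<ge> 0" if "x \<in> A" "y \<notin> A" for x y
    using bias_nonneg[OF that] r_nonneg by (simp add: k_def)
  then show "K \<ge> 0" unfolding K_def by (intro sum_nonneg) auto
  show "r x y + r y x \<le> K * bias x y" if "x \<in> A" "y \<notin> A" for x y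
  proof (cases "bias x y = 0")
    case True
    then show ?thesis using bias_zeroD[OF that] by simp
  next
    case False
    have "k x y \<le> (\<Sum>y\<in>- A. k x y)" using k that by (intro member_le_sum) auto
    also have "\<dots> \<le> K" unfolding K_def using k that by (intro member_le_sum sum_nonneg) auto
    finally have "k x y * bias x y \<le> K * bias x y" using bias_nonneg[OF that] by (rule mult_right_mono)
    then show ?thesis using False by (simp add: k_def)
  qed
qed

lemma off_mass_nonneg: "off_mass N \<eta> \<ge> 0"
  unfolding off_mass_def by (intro sum_nonneg dens_nonneg)

lemma dens_le_off_mass: "y \<notin> A \<Longrightarrow> dens N \<eta> y \<le> off_mass N \<eta>"
  unfolding off_mass_def by (intro member_le_sum dens_nonneg) auto

lemma dens_avg_ind_off: "dens_avg N ind_off \<eta> = off_mass N \<eta>"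
  unfolding dens_avg_def off_mass_def ind_off_def
  by (intro sum.mono_neutral_cong_right) auto

lemma drain_nonneg: "y \<notin> A \<Longrightarrow> drain N y \<eta> \<ge> 0"
  unfolding drain_def by (intro sum_nonneg mult_nonneg_nonneg bias_nonneg dens_nonneg)

lemma drain_total_nonneg: "drain_total N \<eta> \<ge> 0"
  unfolding drain_total_def by (intro sum_nonneg drain_nonneg) auto

lemma pair_le_drain: "x \<in> A \<Longrightarrow> y \<notin> A \<Longrightarrow> bias x y * (dens N \<eta> x * dens N \<eta> y) \<le> drain N y \<eta>"
  unfolding drain_def
  by (intro member_le_sum[of x A "\<lambda>a. bias a y * (dens N \<eta> a * dens N \<eta> y)"])
    (auto intro!: mult_nonneg_nonneg bias_nonneg dens_nonneg)

lemma drain_le_drain_total: "y \<notin> A \<Longrightarrow> drain N y \<eta> \<le> drain_total N \<eta>"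
  unfolding drain_total_def using drain_nonneg by (intro member_le_sum) auto

lemma pair_le_drain_total: "x \<in> A \<Longrightarrow> y \<notin> A \<Longrightarrow> bias x y * (dens N \<eta> x * dens N \<eta> y) \<le> drain_total N \<eta>"
  using pair_le_drain drain_le_drain_total by (rule order.trans)

lemma pair_sum_ind: "pair_sum N (incr (ind x)) \<eta> = (\<Sum>b\<in>UNIV. bias x b * (dens N \<eta> x * dens N \<eta> b))"
proof -
  let ?w = "\<lambda>a b. dens N \<eta> a * dens N \<eta> b * r a b"
  have "pair_sum N (incr (ind x)) \<eta> = (\<Sum>a\<in>UNIV. \<Sum>b\<in>UNIV. ?w a b * of_bool (b = x))
      - (\<Sum>a\<in>UNIV. \<Sum>b\<in>UNIV. ?w a b * of_bool (a = x))"
    by (simp add: pair_sum_def incr_def ind_def right_diff_distrib sum_subtractf)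
  also have "(\<Sum>a\<in>UNIV. \<Sum>b\<in>UNIV. ?w a b * of_bool (b = x)) = (\<Sum>a\<in>UNIV. ?w a x)" by simp
  also have "(\<Sum>a\<in>UNIV. \<Sum>b\<in>UNIV. ?w a b * of_bool (a = x)) = (\<Sum>b\<in>UNIV. ?w x b)"
    by (subst sum.swap) simp
  finally show ?thesis by (simp add: sum_subtractf[symmetric] bias_def algebra_simps)
qed

text \<open>Exchange inside \<open>A\<close> is symmetric and has no net effect on the density at
  \<open>x\<close>.\<close>

lemma pair_sum_ind_in:
  assumes "x \<in> A"
  shows "pair_sum N (incr (ind x)) \<eta> = (\<Sum>b\<in>- A. bias x b * (dens N \<eta> x * dens N \<eta> b))"
  unfolding pair_sum_ind using sym[OF assms]
  by (intro sum.mono_neutral_right) (auto simp: bias_def)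

lemma pair_sum_ind_in_bounds:
  assumes "x \<in> A"
  shows "0 \<le> pair_sum N (incr (ind x)) \<eta>" and "pair_sum N (incr (ind x)) \<eta> \<le> drain_total N \<eta>"
  unfolding pair_sum_ind_in[OF assms] drain_total_def
  using assms by (auto intro!: sum_nonneg sum_mono pair_le_drain mult_nonneg_nonneg bias_nonneg dens_nonneg)

lemma pair_sum_ind_out: "pair_sum N (incr (ind y)) \<eta> = off_flux N y \<eta> - drain N y \<eta>"
proof -
  have "pair_sum N (incr (ind y)) \<eta> = (\<Sum>b\<in>- A. bias y b * (dens N \<eta> y * dens N \<eta> b))
      + (\<Sum>b\<in>A. bias y b * (dens N \<eta> y * dens N \<eta> b))"
    unfolding pair_sum_ind by (subst sum.subset_diff[of A UNIV]) (auto simp: Compl_eq_Diff_UNIV)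
  also have "(\<Sum>b\<in>A. bias y b * (dens N \<eta> y * dens N \<eta> b)) = - drain N y \<eta>"
    unfolding drain_def sum_negf[symmetric] by (intro sum.cong) (auto simp: bias_def algebra_simps)
  finally show ?thesis by (simp add: off_flux_def mult.commute)
qed

text \<open>\<open>bias\<close> is antisymmetric, so swapping the two sums changes the sign.\<close>

lemma sum_off_flux: "(\<Sum>y\<in>- A. off_flux N y \<eta>) = 0"
proof -
  have "(\<Sum>y\<in>- A. off_flux N y \<eta>) = (\<Sum>a\<in>- A. \<Sum>y\<in>- A. bias y a * (dens N \<eta> a * dens N \<eta> y))"
    unfolding off_flux_def by (rule sum.swap)
  also have "\<dots> = (\<Sum>a\<in>- A. - off_flux N a \<eta>)"
    unfolding off_flux_def sum_negf[symmetric] by (intro sum.cong refl) (simp add: bias_def algebra_simps)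
  finally show ?thesis by (simp add: sum_negf)
qed

lemma pair_sum_sum: "pair_sum N (\<lambda>a b. \<Sum>i\<in>I. w i a b) \<eta> = (\<Sum>i\<in>I. pair_sum N (w i) \<eta>)"
proof -
  have "pair_sum N (\<lambda>a b. \<Sum>i\<in>I. w i a b) \<eta>
     = (\<Sum>a\<in>UNIV. \<Sum>i\<in>I. \<Sum>b\<in>UNIV. dens N \<eta> a * dens N \<eta> b * r a b * w i a b)"
    unfolding pair_sum_def sum_distrib_left by (intro sum.cong refl sum.swap)
  also have "\<dots> = (\<Sum>i\<in>I. pair_sum N (w i) \<eta>)" unfolding pair_sum_def by (rule sum.swap)
  finally show ?thesis .
qed

lemma pair_sum_ind_off: "pair_sum N (incr ind_off) \<eta> = - drain_total N \<eta>"
proof -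
  have "ind_off z = (\<Sum>y\<in>- A. ind y z)" for z
    by (simp add: ind_off_def ind_def of_bool_def)
  then have "incr ind_off = (\<lambda>a b. \<Sum>y\<in>- A. incr (ind y) a b)"
    by (simp add: incr_def fun_eq_iff sum_subtractf)
  then have "pair_sum N (incr ind_off) \<eta> = (\<Sum>y\<in>- A. pair_sum N (incr (ind y)) \<eta>)" by (simp add: pair_sum_sum)
  then show ?thesis by (simp add: pair_sum_ind_out sum_subtractf sum_off_flux drain_total_def)
qed

text \<open>Both indicators change only in a jump between \<open>x\<close> and \<open>y\<close>, and
  then with opposite signs.\<close>

lemma pair_sum_ind_ind:
  assumes "x \<noteq> y"
  shows "pair_sum N (\<lambda>a b. incr (ind x) a b * incr (ind y) a b) \<eta> = - (dens N \<eta> x * dens N \<eta> y * (r x y + r y x))"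
proof -
  have *: "incr (ind x) a b * incr (ind y) a b
      = - (of_bool (a = x) * of_bool (b = y)) - of_bool (a = y) * of_bool (b = x)" for a b
    using assms by (auto simp: incr_def ind_def)
  show ?thesis
    unfolding pair_sum_def * right_diff_distrib sum_subtractf mult_minus_right sum_negf sum_sum_of_bool
    by (simp add: algebra_simps)
qed

lemma pair_rates_le_drain_total:
  assumes K: "\<And>x y. x \<in> A \<Longrightarrow> y \<notin> A \<Longrightarrow> r x y + r y x \<le> K * bias x y" "K \<ge> 0"
    and xy: "x \<in> A" "y \<notin> A"
  shows "dens N \<eta> x * dens N \<eta> y * (r x y + r y x) \<le> K * drain_total N \<eta>"
proof -
  have "dens N \<eta> x * dens N \<eta> y * (r x y + r y x) \<le> dens N \<eta> x * dens N \<eta> y * (K * bias x y)"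
    using K(1)[OF xy] dens_nonneg by (intro mult_left_mono mult_nonneg_nonneg) auto
  also have "\<dots> = K * (bias x y * (dens N \<eta> x * dens N \<eta> y))" by (simp add: mult_ac)
  also have "\<dots> \<le> K * drain_total N \<eta>" using pair_le_drain_total[OF xy] K(2) by (rule mult_left_mono)
  finally show ?thesis .
qed

lemma pair_sum_ind_ind_bound:
  assumes K: "\<And>x y. x \<in> A \<Longrightarrow> y \<notin> A \<Longrightarrow> r x y + r y x \<le> K * bias x y" "K \<ge> 0"
    and xy: "x \<in> A" "y \<notin> A"
  shows "\<bar>pair_sum N (\<lambda>a b. incr (ind x) a b * incr (ind y) a b) \<eta>\<bar> \<le> K * drain_total N \<eta>"
proof -
  have "x \<noteq> y" using xy by auto
  have "\<bar>pair_sum N (\<lambda>a b. incr (ind x) a b * incr (ind y) a b) \<eta>\<bar>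
      = dens N \<eta> x * dens N \<eta> y * (r x y + r y x)"
    unfolding pair_sum_ind_ind[OF \<open>x \<noteq> y\<close>] abs_minus_cancel
    using r_nonneg[of x y] r_nonneg[of y x] dens_nonneg[of N \<eta>] by simp
  also have "\<dots> \<le> K * drain_total N \<eta>" by (rule pair_rates_le_drain_total[OF K xy])
  finally show ?thesis .
qed

text \<open>Only jumps across the border of \<open>A\<close> change \<open>ind_off\<close>; the two
  cardinalities merely count all pairs.\<close>

lemma pair_sum_ind_off_sq_bound:
  assumes K: "\<And>x y. x \<in> A \<Longrightarrow> y \<notin> A \<Longrightarrow> r x y + r y x \<le> K * bias x y" "K \<ge> 0"
  shows "\<bar>pair_sum N (\<lambda>a b. incr ind_off a b * incr ind_off a b) \<eta>\<bar>
      \<le> real CARD('a) * (real CARD('a) * K) * drain_total N \<eta>"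
proof -
  note pair = pair_rates_le_drain_total[OF K]
  have le: "dens N \<eta> x * dens N \<eta> y * r x y \<le> dens N \<eta> x * dens N \<eta> y * (r x y + r y x)" for x y
    using r_nonneg dens_nonneg by (intro mult_left_mono mult_nonneg_nonneg) auto
  have "\<bar>dens N \<eta> a * dens N \<eta> b * r a b * (incr ind_off a b * incr ind_off a b)\<bar> \<le> K * drain_total N \<eta>" for a b
  proof (cases "a \<in> A \<longleftrightarrow> b \<in> A")
    case True
    then show ?thesis using K(2) drain_total_nonneg by (simp add: incr_def ind_off_def)
  next
    case False
    then have "incr ind_off a b * incr ind_off a b = 1" by (auto simp: incr_def ind_off_def)
    then have "\<bar>dens N \<eta> a * dens N \<eta> b * r a b * (incr ind_off a b * incr ind_off a b)\<bar>
        = dens N \<eta> a * dens N \<eta> b * r a b"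
      by (simp add: abs_mult r_nonneg dens_nonneg)
    also have "\<dots> \<le> K * drain_total N \<eta>"
      using False pair[of a b N \<eta>] le[of a b] pair[of b a N \<eta>] by (auto simp: mult_ac add.commute)
    finally show ?thesis .
  qed
  then have "\<bar>pair_sum N (\<lambda>a b. incr ind_off a b * incr ind_off a b) \<eta>\<bar> \<le> (\<Sum>a\<in>(UNIV::'a set). \<Sum>b\<in>(UNIV::'a set). K * drain_total N \<eta>)"
    unfolding pair_sum_def by (intro order.trans[OF sum_abs] sum_mono)
  then show ?thesis by (simp add: mult.assoc)
qed

section \<open>Weighted expectations of the drain\<close>

text \<open>Test with the mass off \<open>A\<close>: diffusion feeds the complement at a bounded
  rate, and the drain has to return what it brings.\<close>

lemma B_drain_total_bounded:
  obtains C where "C \<ge> 0" "\<And>N. B N (drain_total N) \<le> C"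
proof -
  define P where "P N = (\<Sum>z\<in>UNIV. p N z * (\<Sum>b\<in>UNIV. r z b * incr ind_off z b))" for N
  have "(\<lambda>N. B N (\<lambda>\<eta>. pair_sum N (incr ind_off) \<eta>) + P N) \<longlonglongrightarrow> 0"
    unfolding P_def by (rule linear_balance) (simp add: ind_off_def)
  then have "(\<lambda>N. - B N (drain_total N) + P N) \<longlonglongrightarrow> 0"
    by (simp add: pair_sum_ind_off B_uminus)
  then have "Bseq (\<lambda>N. - B N (drain_total N) + P N)" by (rule convergent_imp_Bseq[OF convergentI])
  then obtain C where C: "C > 0" "\<And>N. \<bar>- B N (drain_total N) + P N\<bar> \<le> C" by (auto simp: Bseq_def)
  have P: "P N \<le> R" for N
    unfolding P_def R_def
  proof (rule sum_mono)
    fix z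
    have "(\<Sum>b\<in>UNIV. r z b * incr ind_off z b) \<le> (\<Sum>b\<in>UNIV. r z b)"
      using r_nonneg by (intro sum_mono mult_left_le) (auto simp: incr_def ind_off_def)
    then have "p N z * (\<Sum>b\<in>UNIV. r z b * incr ind_off z b) \<le> p N z * (\<Sum>b\<in>UNIV. r z b)"
      using p_nonneg by (rule mult_left_mono)
    also have "\<dots> \<le> (\<Sum>b\<in>UNIV. r z b)"
      using p_nonneg p_le_1 r_nonneg by (intro mult_left_le_one_le sum_nonneg) auto
    finally show "p N z * (\<Sum>b\<in>UNIV. r z b * incr ind_off z b) \<le> (\<Sum>b\<in>UNIV. r z b)" .
  qed
  then have "B N (drain_total N) \<le> C + R" for N using C(2)[of N] P[of N] by linarith
  then show thesis using C(1) R_nonneg that[of "C + R"] by simp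
qed

text \<open>This disposes of the \<open>1 / N\<close> corrections in the quadratic and cubic
  relations.\<close>

lemma B_drain_total_over_N: "(\<lambda>N. B N (\<lambda>\<eta>. drain_total N \<eta> / real N)) \<longlonglongrightarrow> 0"
proof -
  obtain C where C: "C \<ge> 0" "\<And>N. B N (drain_total N) \<le> C" by (rule B_drain_total_bounded) blast
  have "norm (B N (\<lambda>\<eta>. drain_total N \<eta> / real N)) \<le> C / real N" for N
    using C(2)[of N] B_nonneg[of N "drain_total N"] drain_total_nonneg
    by (simp add: B_divide divide_right_mono)
  then show ?thesis by (intro Lim_null_comparison[OF _ lim_const_over_n[of C]]) auto
qed

text \<open>Test with the square of the mass off \<open>A\<close>. Its diffusive source
  \<open>P\<close> carries a factor \<open>ind_off z\<close>, so only condensates outside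
  \<open>A\<close> contribute, and these vanish by \<open>p_off\<close>.\<close>

lemma B_off_mass_drain_total: "(\<lambda>N. B N (\<lambda>\<eta>. off_mass N \<eta> * drain_total N \<eta>)) \<longlonglongrightarrow> 0"
proof -
  obtain K where K: "K \<ge> 0" "\<And>x y. x \<in> A \<Longrightarrow> y \<notin> A \<Longrightarrow> r x y + r y x \<le> K * bias x y"
    by (rule rates_le_bias) blast
  define Q where "Q N \<eta> = pair_sum N (\<lambda>a b. incr ind_off a b * incr ind_off a b) \<eta> / real N" for N \<eta>
  define P where "P N = (\<Sum>z\<in>UNIV. p N z *
     (\<Sum>b\<in>UNIV. r z b * (ind_off z * incr ind_off z b + ind_off z * incr ind_off z b)))" for N
  have Q: "(\<lambda>N. B N (Q N)) \<longlonglongrightarrow> 0"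
  proof (rule B_squeeze[OF _ B_drain_total_over_N])
    fix N :: nat and \<eta> :: "'a \<Rightarrow> nat"
    show "\<bar>Q N \<eta>\<bar> \<le> (real CARD('a) * (real CARD('a) * K)) * (drain_total N \<eta> / real N)"
      using divide_right_mono[OF pair_sum_ind_off_sq_bound[OF K(2,1), of N \<eta>], of "real N"]
      by (simp add: Q_def)
  qed
  have P: "P \<longlonglongrightarrow> 0"
    unfolding P_def
  proof (intro tendsto_null_sum)
    fix z
    show "(\<lambda>N. p N z * (\<Sum>b\<in>UNIV. r z b * (ind_off z * incr ind_off z b + ind_off z * incr ind_off z b))) \<longlonglongrightarrow> 0"
      using tendsto_mult_left_zero[OF p_off[of z]] by (cases "z \<in> A") (auto simp: ind_off_def)
  qed
  have "(\<lambda>N. B N (\<lambda>\<eta>. dens_avg N ind_off \<eta> * pair_sum N (incr ind_off) \<eta>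
      + dens_avg N ind_off \<eta> * pair_sum N (incr ind_off) \<eta> + Q N \<eta>) + P N) \<longlonglongrightarrow> 0"
    unfolding Q_def P_def by (rule quadratic_balance) (auto simp: ind_off_def)
  then have "(\<lambda>N. - (2 * B N (\<lambda>\<eta>. off_mass N \<eta> * drain_total N \<eta>)) + B N (Q N) + P N) \<longlonglongrightarrow> 0"
    unfolding B_add dens_avg_ind_off pair_sum_ind_off mult_minus_right B_uminus by simp
  from tendsto_diff[OF tendsto_diff[OF this Q] P]
  have "(\<lambda>N. - (2 * B N (\<lambda>\<eta>. off_mass N \<eta> * drain_total N \<eta>))) \<longlonglongrightarrow> 0" by simp
  from tendsto_mult_right_zero[OF this, of "- 1 / 2"] show ?thesis by simp
qed

text \<open>Test with the product of the densities at \<open>x\<close> and \<open>y\<close>.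
  Diffusion from the condensate at \<open>x\<close> is the source \<open>p N x * r x y\<close>; the
  change of the density at \<open>x\<close> is of size \<open>drain_total\<close> and comes with a
  factor at most \<open>off_mass\<close>.\<close>

lemma B_dens_flux:
  assumes xy: "x \<in> A" "y \<notin> A"
  shows "(\<lambda>N. B N (\<lambda>\<eta>. dens N \<eta> x * (drain N y \<eta> - off_flux N y \<eta>)) - p N x * r x y) \<longlonglongrightarrow> 0"
proof -
  obtain K where K: "K \<ge> 0" "\<And>x y. x \<in> A \<Longrightarrow> y \<notin> A \<Longrightarrow> r x y + r y x \<le> K * bias x y"
    by (rule rates_le_bias) blast
  have ne: "x \<noteq> y" using xy by auto
  define Q where "Q N \<eta> = pair_sum N (\<lambda>a b. incr (ind x) a b * incr (ind y) a b) \<eta> / real N" for N \<eta>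
  have Q: "(\<lambda>N. B N (Q N)) \<longlonglongrightarrow> 0"
  proof (rule B_squeeze[OF _ B_drain_total_over_N])
    fix N :: nat and \<eta> :: "'a \<Rightarrow> nat"
    show "\<bar>Q N \<eta>\<bar> \<le> K * (drain_total N \<eta> / real N)"
      using divide_right_mono[OF pair_sum_ind_ind_bound[OF K(2,1) xy, of N \<eta>], of "real N"]
      by (simp add: Q_def)
  qed
  have Y: "(\<lambda>N. B N (\<lambda>\<eta>. dens N \<eta> y * pair_sum N (incr (ind x)) \<eta>)) \<longlonglongrightarrow> 0"
  proof (rule B_squeeze[OF _ B_off_mass_drain_total])
    fix N :: nat and \<eta> :: "'a \<Rightarrow> nat"
    show "\<bar>dens N \<eta> y * pair_sum N (incr (ind x)) \<eta>\<bar> \<le> 1 * (off_mass N \<eta> * drain_total N \<eta>)"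
      using pair_sum_ind_in_bounds[OF xy(1), of N \<eta>] dens_le_off_mass[OF xy(2), of N \<eta>] dens_nonneg[of N \<eta> y]
      by (auto simp: abs_mult intro!: mult_mono)
  qed
  have inner: "(\<Sum>b\<in>UNIV. r z b * (ind x z * incr (ind y) z b + ind y z * incr (ind x) z b))
      = of_bool (z = x) * r x y + of_bool (z = y) * r y x" for z
    using ne by (cases "z = x"; cases "z = y") (simp_all add: ind_def incr_def)
  have P: "(\<Sum>z\<in>UNIV. p N z * (\<Sum>b\<in>UNIV. r z b * (ind x z * incr (ind y) z b + ind y z * incr (ind x) z b)))
      = p N x * r x y + p N y * r y x" for N
  proof -
    have "p N z * (of_bool (z = x) * r x y + of_bool (z = y) * r y x)
        = (p N z * r x y) * of_bool (z = x) + (p N z * r y x) * of_bool (z = y)" for z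
      by (simp add: algebra_simps)
    then show ?thesis unfolding inner by (simp add: sum.distrib)
  qed
  have "(\<lambda>N. B N (\<lambda>\<eta>. dens_avg N (ind x) \<eta> * pair_sum N (incr (ind y)) \<eta> + dens_avg N (ind y) \<eta> * pair_sum N (incr (ind x)) \<eta>
      + Q N \<eta>) + (p N x * r x y + p N y * r y x)) \<longlonglongrightarrow> 0"
    unfolding Q_def P[symmetric] by (intro quadratic_balance ind_bound)
  then have "(\<lambda>N. B N (\<lambda>\<eta>. dens N \<eta> x * pair_sum N (incr (ind y)) \<eta>)
      + B N (\<lambda>\<eta>. dens N \<eta> y * pair_sum N (incr (ind x)) \<eta>) + B N (Q N) + (p N x * r x y + p N y * r y x)) \<longlonglongrightarrow> 0"
    by (simp add: B_add dens_avg_ind)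
  from tendsto_diff[OF tendsto_diff[OF tendsto_diff[OF this Q] Y] tendsto_mult_left_zero[OF p_off[OF xy(2)], of "r y x"]]
  have "(\<lambda>N. B N (\<lambda>\<eta>. dens N \<eta> x * pair_sum N (incr (ind y)) \<eta>) + p N x * r x y) \<longlonglongrightarrow> 0"
    by (simp add: algebra_simps)
  from tendsto_minus[OF this] show ?thesis
    by (simp add: pair_sum_ind_out B_diff right_diff_distrib algebra_simps)
qed

lemma off_flux_bound: "\<bar>off_flux N y \<eta>\<bar> \<le> R * (off_mass N \<eta> * dens N \<eta> y)"
proof -
  have "\<bar>off_flux N y \<eta>\<bar> \<le> (\<Sum>a\<in>- A. R * (dens N \<eta> a * dens N \<eta> y))"
    unfolding off_flux_def
  proof (intro order.trans[OF sum_abs] sum_mono)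
    fix a
    show "\<bar>bias y a * (dens N \<eta> a * dens N \<eta> y)\<bar> \<le> R * (dens N \<eta> a * dens N \<eta> y)"
      using bias_le_R[of y a] by (simp add: abs_mult dens_nonneg mult_right_mono)
  qed
  then show ?thesis by (simp add: off_mass_def sum_distrib_left sum_distrib_right)
qed

lemma pair_le_drain_total_div:
  assumes "x \<in> A" "y \<notin> A" "bias x y > 0"
  shows "dens N \<eta> x * dens N \<eta> y \<le> drain_total N \<eta> / bias x y"
  using pair_le_drain_total[OF assms(1,2), of N \<eta>] assms(3) by (simp add: pos_le_divide_eq mult.commute)

text \<open>For an attached pair, \<open>dens N \<eta> x * dens N \<eta> y\<close> is controlled by
  the drain, at the price of \<open>1 / bias x y\<close>; the second site outside \<open>A\<close>
  supplies the factor \<open>off_mass\<close>.\<close>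

lemma dens_off_flux_bound:
  assumes "x \<in> A" "y \<notin> A" "bias x y > 0"
  shows "\<bar>dens N \<eta> x * off_flux N y \<eta>\<bar> \<le> R / bias x y * (off_mass N \<eta> * drain_total N \<eta>)"
proof -
  have "\<bar>dens N \<eta> x * off_flux N y \<eta>\<bar> \<le> dens N \<eta> x * (R * (off_mass N \<eta> * dens N \<eta> y))"
    unfolding abs_mult using off_flux_bound dens_nonneg by (intro mult_mono) auto
  also have "\<dots> = (R * off_mass N \<eta>) * (dens N \<eta> x * dens N \<eta> y)" by (simp add: mult_ac)
  also have "\<dots> \<le> (R * off_mass N \<eta>) * (drain_total N \<eta> / bias x y)"
    using pair_le_drain_total_div[OF assms] R_nonneg off_mass_nonneg by (intro mult_left_mono) auto
  finally show ?thesis by simp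
qed

lemma B_dens_drain_attached:
  assumes "x \<in> A" "y \<notin> A" "bias x y > 0"
  shows "(\<lambda>N. B N (\<lambda>\<eta>. dens N \<eta> x * drain N y \<eta>) - p N x * r x y) \<longlonglongrightarrow> 0"
proof -
  have "(\<lambda>N. B N (\<lambda>\<eta>. dens N \<eta> x * off_flux N y \<eta>)) \<longlonglongrightarrow> 0"
    by (rule B_squeeze[OF dens_off_flux_bound[OF assms] B_off_mass_drain_total])
  from tendsto_add[OF B_dens_flux[OF assms(1,2)] this] show ?thesis
    by (simp add: right_diff_distrib B_diff)
qed

text \<open>For unattached pairs the flux inside the complement of A does not vanish site by site,
  but it is antisymmetric and cancels after summation over all sites.\<close>
lemma B_dens_drain:
  assumes x: "x \<in> A" and y: "y \<notin> A"
  shows "(\<lambda>N. B N (\<lambda>\<eta>. dens N \<eta> x * drain N y \<eta>) - p N x * r x y) \<longlonglongrightarrow> 0"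
proof (cases "bias x y > 0")
  case True
  then show ?thesis using B_dens_drain_attached assms by blast
next
  case False
  define Z where "Z y N = B N (\<lambda>\<eta>. dens N \<eta> x * drain N y \<eta>) - p N x * r x y" for y N
  define U where "U = {y \<in> - A. bias x y > 0}"
  have "(\<lambda>N. \<Sum>y\<in>- A. B N (\<lambda>\<eta>. dens N \<eta> x * (drain N y \<eta> - off_flux N y \<eta>)) - p N x * r x y) \<longlonglongrightarrow> 0"
    by (intro tendsto_null_sum B_dens_flux x) auto
  moreover have "(\<Sum>y\<in>- A. B N (\<lambda>\<eta>. dens N \<eta> x * (drain N y \<eta> - off_flux N y \<eta>)) - p N x * r x y) = (\<Sum>y\<in>- A. Z y N)" for N
  proof -
    have "(\<Sum>y\<in>- A. B N (\<lambda>\<eta>. dens N \<eta> x * off_flux N y \<eta>)) = 0"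
      unfolding B_sum[symmetric] sum_distrib_left[symmetric] sum_off_flux by (simp add: B_def E_const)
    then show ?thesis by (simp add: Z_def right_diff_distrib B_diff sum_subtractf)
  qed
  ultimately have "(\<lambda>N. \<Sum>y\<in>- A. Z y N) \<longlonglongrightarrow> 0" by simp
  moreover have "(\<lambda>N. \<Sum>y\<in>U. Z y N) \<longlonglongrightarrow> 0"
    unfolding Z_def by (intro tendsto_null_sum B_dens_drain_attached x) (auto simp: U_def)
  ultimately have "(\<lambda>N. (\<Sum>y\<in>- A. Z y N) - (\<Sum>y\<in>U. Z y N)) \<longlonglongrightarrow> 0 - 0" by (rule tendsto_diff)
  moreover have "(\<Sum>y\<in>- A. Z y N) - (\<Sum>y\<in>U. Z y N) = (\<Sum>y\<in>- A - U. Z y N)" for N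
    by (rule sum_diff[symmetric]) (auto simp: U_def)
  ultimately have lim: "(\<lambda>N. \<Sum>y\<in>- A - U. Z y N) \<longlonglongrightarrow> 0" by simp
  \<comment> \<open>An unattached \<open>z\<close> has \<open>r x z = 0\<close>, so
    \<open>Z z N\<close> is the expectation of a nonnegative quantity, and a vanishing sum controls
    each term.\<close>
  have nn: "Z z N \<ge> 0" if "z \<in> - A - U" for z N
  proof -
    have z: "z \<notin> A" "bias x z = 0" using that bias_nonneg[OF x, of z] by (auto simp: U_def)
    then show ?thesis
      using bias_zeroD[OF x z] by (auto simp: Z_def intro!: B_nonneg mult_nonneg_nonneg dens_nonneg drain_nonneg)
  qed
  have yU: "y \<in> - A - U" using y False by (simp add: U_def)
  have "(\<lambda>N. Z y N) \<longlonglongrightarrow> 0"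
  proof (rule Lim_null_comparison[OF always_eventually lim], rule allI)
    fix N
    show "norm (Z y N) \<le> (\<Sum>y\<in>- A - U. Z y N)"
      using nn[OF yU, of N] member_le_sum[OF yU, of "\<lambda>y. Z y N"] nn by simp
  qed
  then show ?thesis by (simp add: Z_def)
qed

section \<open>Separating the sites of \<open>A\<close> inside the drain\<close>

text \<open>Test with the product of the densities at \<open>x\<close>, \<open>x'\<close> and
  \<open>y\<close>. It has no source in the limit: after one diffusive jump from a condensed
  configuration at most two sites are occupied.\<close>

lemma B_dens_dens_drain:
  assumes x: "x \<in> A" and x': "x' \<in> A" and ne: "x \<noteq> x'" and y: "y \<notin> A" and c: "bias x y > 0"
  shows "(\<lambda>N. B N (\<lambda>\<eta>. dens N \<eta> x * dens N \<eta> x' * drain N y \<eta>)) \<longlonglongrightarrow> 0"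
proof -
  obtain K where K: "K \<ge> 0" "\<And>x y. x \<in> A \<Longrightarrow> y \<notin> A \<Longrightarrow> r x y + r y x \<le> K * bias x y"
    by (rule rates_le_bias) blast
  have dist: "x \<noteq> y" "x' \<noteq> y" using x x' y by auto
  note dn = dens_nonneg
  define Q1 where "Q1 N \<eta> = dens N \<eta> x * pair_sum N (\<lambda>a b. incr (ind x') a b * incr (ind y) a b) \<eta> / real N" for N \<eta>
  define Q2 where "Q2 N \<eta> = dens N \<eta> x' * pair_sum N (\<lambda>a b. incr (ind x) a b * incr (ind y) a b) \<eta> / real N" for N \<eta>
  define Q3 where "Q3 N \<eta> = dens N \<eta> y * pair_sum N (\<lambda>a b. incr (ind x) a b * incr (ind x') a b) \<eta> / real N" for N \<eta>
  have Q12: "(\<lambda>N. B N (\<lambda>\<eta>. dens N \<eta> u * pair_sum N (\<lambda>a b. incr (ind w) a b * incr (ind y) a b) \<eta> / real N)) \<longlonglongrightarrow> 0"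
    if "w \<in> A" for u w
  proof (rule B_squeeze[OF _ B_drain_total_over_N])
    fix N :: nat and \<eta> :: "'a \<Rightarrow> nat" assume N: "N > 0" and \<eta>: "\<eta> \<in> configs N"
    have "\<bar>dens N \<eta> u * pair_sum N (\<lambda>a b. incr (ind w) a b * incr (ind y) a b) \<eta>\<bar> \<le> 1 * (K * drain_total N \<eta>)"
      unfolding abs_mult using dens_le_1[OF \<eta>] pair_sum_ind_ind_bound[OF K(2,1) that y]
      by (intro mult_mono) (auto simp: dn)
    from divide_right_mono[OF this, of "real N"]
    show "\<bar>dens N \<eta> u * pair_sum N (\<lambda>a b. incr (ind w) a b * incr (ind y) a b) \<eta> / real N\<bar> \<le> K * (drain_total N \<eta> / real N)"
      by simp
  qed
  have Q1: "(\<lambda>N. B N (Q1 N)) \<longlonglongrightarrow> 0" and Q2: "(\<lambda>N. B N (Q2 N)) \<longlonglongrightarrow> 0"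
    unfolding Q1_def Q2_def using Q12 x x' by auto
  have Q3: "(\<lambda>N. B N (Q3 N)) \<longlonglongrightarrow> 0"
  proof (rule B_squeeze[OF _ B_drain_total_over_N])
    fix N :: nat and \<eta> :: "'a \<Rightarrow> nat" assume N: "N > 0" and \<eta>: "\<eta> \<in> configs N"
    \<comment> \<open>The increments here come from exchange inside \<open>A\<close>, which the
      drain does not see; the outer factor \<open>dens N \<eta> y\<close> is paired with the
      attached site \<open>x\<close> instead.\<close>
    have "\<bar>dens N \<eta> y * pair_sum N (\<lambda>a b. incr (ind x) a b * incr (ind x') a b) \<eta>\<bar>
      = (dens N \<eta> x * dens N \<eta> y) * (dens N \<eta> x' * (r x x' + r x' x))"
      unfolding pair_sum_ind_ind[OF ne] by (simp add: abs_mult dn r_nonneg mult_ac)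
    also have "\<dots> \<le> (drain_total N \<eta> / bias x y) * (1 * (r x x' + r x' x))"
      using pair_le_drain_total_div[OF x y c] dens_le_1[OF \<eta>] drain_total_nonneg c
      by (intro mult_mono mult_nonneg_nonneg) (auto simp: dn r_nonneg)
    finally have "\<bar>dens N \<eta> y * pair_sum N (\<lambda>a b. incr (ind x) a b * incr (ind x') a b) \<eta>\<bar>
      \<le> (r x x' + r x' x) / bias x y * drain_total N \<eta>" by (simp add: mult.commute)
    from divide_right_mono[OF this, of "real N"]
    show "\<bar>Q3 N \<eta>\<bar> \<le> (r x x' + r x' x) / bias x y * (drain_total N \<eta> / real N)"
      by (simp add: Q3_def)
  qed
  have T: "(\<lambda>N. B N (\<lambda>\<eta>. dens N \<eta> u * dens N \<eta> y * pair_sum N (incr (ind w)) \<eta>)) \<longlonglongrightarrow> 0" if "w \<in> A" for u w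
  proof (rule B_squeeze[OF _ B_off_mass_drain_total])
    fix N :: nat and \<eta> :: "'a \<Rightarrow> nat" assume N: "N > 0" and \<eta>: "\<eta> \<in> configs N"
    have "\<bar>dens N \<eta> u * dens N \<eta> y * pair_sum N (incr (ind w)) \<eta>\<bar> \<le> (1 * off_mass N \<eta>) * drain_total N \<eta>"
      unfolding abs_mult using dens_le_1[OF \<eta>] dens_le_off_mass[OF y] pair_sum_ind_in_bounds[OF that, of N \<eta>] off_mass_nonneg
      by (intro mult_mono mult_nonneg_nonneg) (auto simp: dn)
    then show "\<bar>dens N \<eta> u * dens N \<eta> y * pair_sum N (incr (ind w)) \<eta>\<bar> \<le> 1 * (off_mass N \<eta> * drain_total N \<eta>)" by simp
  qed
  have Wl: "(\<lambda>N. B N (\<lambda>\<eta>. dens N \<eta> x * dens N \<eta> x' * off_flux N y \<eta>)) \<longlonglongrightarrow> 0"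
  proof (rule B_squeeze[OF _ B_off_mass_drain_total])
    fix N :: nat and \<eta> :: "'a \<Rightarrow> nat" assume N: "N > 0" and \<eta>: "\<eta> \<in> configs N"
    have "\<bar>dens N \<eta> x * dens N \<eta> x' * off_flux N y \<eta>\<bar> = dens N \<eta> x' * \<bar>dens N \<eta> x * off_flux N y \<eta>\<bar>"
      by (simp add: abs_mult dn mult_ac)
    also have "\<dots> \<le> \<bar>dens N \<eta> x * off_flux N y \<eta>\<bar>"
      using dens_le_1[OF \<eta>] by (intro mult_left_le_one_le) (auto simp: dn)
    also have "\<dots> \<le> R / bias x y * (off_mass N \<eta> * drain_total N \<eta>)" by (rule dens_off_flux_bound[OF x y c])
    finally show "\<bar>dens N \<eta> x * dens N \<eta> x' * off_flux N y \<eta>\<bar> \<le> R / bias x y * (off_mass N \<eta> * drain_total N \<eta>)" .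
  qed
  have triple: "(\<lambda>a b. incr (ind x) a b * incr (ind x') a b * incr (ind y) a b) = (\<lambda>a b. 0)"
    using ne dist by (auto simp: fun_eq_iff incr_def ind_def)
  have S0: "pair_sum N (\<lambda>a b. 0) \<eta> = 0" for N \<eta> by (simp add: pair_sum_def)
  have Pz: "(\<Sum>b\<in>UNIV. r z b * (ind x z * ind x' z * incr (ind y) z b
     + ind x z * ind y z * incr (ind x') z b + ind x' z * ind y z * incr (ind x) z b)) = 0" for z
    using ne dist by (simp add: ind_def)
  have "(\<lambda>N. B N (\<lambda>\<eta>. dens N \<eta> x * dens N \<eta> x' * pair_sum N (incr (ind y)) \<eta>
      + dens N \<eta> x * dens N \<eta> y * pair_sum N (incr (ind x')) \<eta>
      + dens N \<eta> x' * dens N \<eta> y * pair_sum N (incr (ind x)) \<eta> + (Q1 N \<eta> + Q2 N \<eta> + Q3 N \<eta>))) \<longlonglongrightarrow> 0"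
    using cubic_balance[of "ind x" "ind x'" "ind y", OF ind_bound ind_bound ind_bound]
    unfolding triple S0 Pz dens_avg_ind by (simp add: Q1_def Q2_def Q3_def add_divide_distrib)
  then have "(\<lambda>N. B N (\<lambda>\<eta>. dens N \<eta> x * dens N \<eta> x' * pair_sum N (incr (ind y)) \<eta>)
      + B N (\<lambda>\<eta>. dens N \<eta> x * dens N \<eta> y * pair_sum N (incr (ind x')) \<eta>)
      + B N (\<lambda>\<eta>. dens N \<eta> x' * dens N \<eta> y * pair_sum N (incr (ind x)) \<eta>)
      + (B N (Q1 N) + B N (Q2 N) + B N (Q3 N))) \<longlonglongrightarrow> 0"
    by (simp add: B_add)
  from tendsto_diff[OF tendsto_diff[OF tendsto_diff[OF this tendsto_add[OF tendsto_add[OF Q1 Q2] Q3]]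
      T[OF x, of x']] T[OF x', of x]]
  have "(\<lambda>N. B N (\<lambda>\<eta>. dens N \<eta> x * dens N \<eta> x' * pair_sum N (incr (ind y)) \<eta>)) \<longlonglongrightarrow> 0" by simp
  from tendsto_diff[OF Wl this] show ?thesis
    by (simp add: pair_sum_ind_out right_diff_distrib B_diff)
qed

lemma B_pair_bounded:
  assumes "x \<in> A" "y \<notin> A" "bias x y > 0"
  obtains C where "C \<ge> 0" "\<And>N. B N (\<lambda>\<eta>. dens N \<eta> x * dens N \<eta> y) \<le> C"
proof -
  obtain C where C: "C \<ge> 0" "\<And>N. B N (drain_total N) \<le> C" by (rule B_drain_total_bounded) blast
  have "B N (\<lambda>\<eta>. dens N \<eta> x * dens N \<eta> y) \<le> B N (\<lambda>\<eta>. drain_total N \<eta> / bias x y)" for N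
    by (intro B_mono pair_le_drain_total_div assms)
  also have "B N (\<lambda>\<eta>. drain_total N \<eta> / bias x y) \<le> C / bias x y" for N
    using C(2)[of N] assms(3) by (simp add: B_divide divide_right_mono)
  finally show thesis using that[of "C / bias x y"] C(1) assms(3) by simp
qed

text \<open>If \<open>x'\<close> is unattached, its drain product has limit zero and contains the
  triple product. If both sites are attached, the cubic relation controls the triple product with
  \<open>dens N \<eta> x\<close> squared, and the extra factor is removed by truncation.\<close>

lemma B_triple:
  assumes x: "x \<in> A" and x': "x' \<in> A" and ne: "x \<noteq> x'" and y: "y \<notin> A" and c: "bias x y > 0"
  shows "(\<lambda>N. B N (\<lambda>\<eta>. dens N \<eta> x * dens N \<eta> x' * dens N \<eta> y)) \<longlonglongrightarrow> 0"
proof (cases "bias x' y > 0")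
  case False
  then have z: "bias x' y = 0" using bias_nonneg[OF x' y] by simp
  have lim: "(\<lambda>N. B N (\<lambda>\<eta>. dens N \<eta> x' * drain N y \<eta>)) \<longlonglongrightarrow> 0"
    using B_dens_drain[OF x' y] bias_zeroD[OF x' y z] by simp
  show ?thesis
  proof (rule B_squeeze[OF _ lim])
    fix N :: nat and \<eta> :: "'a \<Rightarrow> nat"
    have "dens N \<eta> x' * (bias x y * (dens N \<eta> x * dens N \<eta> y)) \<le> dens N \<eta> x' * drain N y \<eta>"
      by (intro mult_left_mono pair_le_drain x y dens_nonneg)
    then show "\<bar>dens N \<eta> x * dens N \<eta> x' * dens N \<eta> y\<bar> \<le> 1 / bias x y * (dens N \<eta> x' * drain N y \<eta>)"
      using c by (simp add: abs_mult dens_nonneg field_simps)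
  qed
next
  case c': True
  obtain C where C: "C \<ge> 0" "\<And>N. B N (\<lambda>\<eta>. dens N \<eta> x' * dens N \<eta> y) \<le> C"
    by (rule B_pair_bounded[OF x' y c']) blast
  \<comment> \<open>\<open>drain N y\<close> contains the contribution of \<open>x\<close> itself,
    which produces the square.\<close>
  have sq: "(\<lambda>N. B N (\<lambda>\<eta>. dens N \<eta> x * dens N \<eta> x * dens N \<eta> x' * dens N \<eta> y)) \<longlonglongrightarrow> 0"
  proof (rule B_squeeze[OF _ B_dens_dens_drain[OF assms]])
    fix N :: nat and \<eta> :: "'a \<Rightarrow> nat"
    have "dens N \<eta> x * dens N \<eta> x' * (bias x y * (dens N \<eta> x * dens N \<eta> y)) \<le> dens N \<eta> x * dens N \<eta> x' * drain N y \<eta>"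
      by (intro mult_left_mono pair_le_drain x y dens_nonneg mult_nonneg_nonneg)
    then show "\<bar>dens N \<eta> x * dens N \<eta> x * dens N \<eta> x' * dens N \<eta> y\<bar>
        \<le> 1 / bias x y * (dens N \<eta> x * dens N \<eta> x' * drain N y \<eta>)"
      using c by (simp add: abs_mult dens_nonneg field_simps)
  qed
  show ?thesis
  proof (rule LIMSEQ_I)
    fix e :: real assume e: "e > 0"
    \<comment> \<open>Truncation level for \<open>dens N \<eta> x\<close>, chosen so that
      \<open>t * C < e / 2\<close>; the \<open>+ 1\<close> covers \<open>C = 0\<close>.\<close>
    define t where "t = e / (2 * (C + 1))"
    have t: "t > 0" using e C(1) by (simp add: t_def)
    have tC: "t * C < e / 2"
    proof -
      have "t * C < t * (C + 1)" using t by simp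
      also have "\<dots> = e / 2" using C(1) by (simp add: t_def field_simps)
      finally show ?thesis .
    qed
    obtain n where n: "\<And>N. N \<ge> n \<Longrightarrow> norm (B N (\<lambda>\<eta>. dens N \<eta> x * dens N \<eta> x * dens N \<eta> x' * dens N \<eta> y) - 0) < t * e / 2"
      using LIMSEQ_D[OF sq, of "t * e / 2"] t e by auto
    have "norm (B N (\<lambda>\<eta>. dens N \<eta> x * dens N \<eta> x' * dens N \<eta> y) - 0) < e" if "N \<ge> n" for N
    proof -
      have nn: "B N (\<lambda>\<eta>. dens N \<eta> x * dens N \<eta> x' * dens N \<eta> y) \<ge> 0"
        by (intro B_nonneg mult_nonneg_nonneg dens_nonneg)
      \<comment> \<open>Below level \<open>t\<close> the bounded expectation of
        \<open>dens N \<eta> x' * dens N \<eta> y\<close> is used, above it the square.\<close>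
      have split_t: "s \<le> t + s * s / t" if "s \<ge> 0" for s
      proof (cases "s \<le> t")
        case True
        have "0 \<le> s * s / t" using t by simp
        with True show ?thesis by linarith
      next
        case False
        then have "s * t \<le> s * s" using that by (intro mult_left_mono) auto
        then have "s \<le> s * s / t" using t by (simp add: pos_le_divide_eq)
        then show ?thesis using t by linarith
      qed
      have "dens N \<eta> x * (dens N \<eta> x' * dens N \<eta> y)
         \<le> (t + dens N \<eta> x * dens N \<eta> x / t) * (dens N \<eta> x' * dens N \<eta> y)" for \<eta>
        by (intro mult_right_mono mult_nonneg_nonneg dens_nonneg split_t)
      then have "B N (\<lambda>\<eta>. dens N \<eta> x * dens N \<eta> x' * dens N \<eta> y)
        \<le> B N (\<lambda>\<eta>. t * (dens N \<eta> x' * dens N \<eta> y) + dens N \<eta> x * dens N \<eta> x * dens N \<eta> x' * dens N \<eta> y / t)"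
        by (intro B_mono) (simp add: algebra_simps)
      also have "\<dots> = t * B N (\<lambda>\<eta>. dens N \<eta> x' * dens N \<eta> y)
          + B N (\<lambda>\<eta>. dens N \<eta> x * dens N \<eta> x * dens N \<eta> x' * dens N \<eta> y) / t"
        by (simp add: B_add B_cmult B_divide)
      also have "\<dots> < e / 2 + e / 2"
      proof (rule add_strict_mono)
        show "t * B N (\<lambda>\<eta>. dens N \<eta> x' * dens N \<eta> y) < e / 2"
          using mult_left_mono[OF C(2)[of N], of t] t tC by linarith
        show "B N (\<lambda>\<eta>. dens N \<eta> x * dens N \<eta> x * dens N \<eta> x' * dens N \<eta> y) / t < e / 2"
          using n[OF that] t by (simp add: divide_less_eq mult.commute abs_less_iff)
      qed
      finally show ?thesis using nn by simp
    qed
    then show "\<exists>n. \<forall>N\<ge>n. norm (B N (\<lambda>\<eta>. dens N \<eta> x * dens N \<eta> x' * dens N \<eta> y) - 0) < e" by blast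
  qed
qed

text \<open>The return flow from \<open>y\<close> to \<open>x\<close> balances the diffusion from
  \<open>x\<close> to \<open>y\<close> pair by pair, not merely after summing over the sites of
  \<open>A\<close>.\<close>

lemma B_pair_limit:
  assumes x: "x \<in> A" and y: "y \<notin> A"
  shows "(\<lambda>N. bias x y * B N (\<lambda>\<eta>. dens N \<eta> x * dens N \<eta> y) - p N x * r x y) \<longlonglongrightarrow> 0"
proof (cases "bias x y > 0")
  case False
  then have "bias x y = 0" using bias_nonneg[OF x y] by simp
  then show ?thesis using bias_zeroD[OF x y] by simp
next
  case c: True
  have outer: "(\<lambda>N. B N (\<lambda>\<eta>. bias x y * (off_mass N \<eta> * (dens N \<eta> x * dens N \<eta> y)))) \<longlonglongrightarrow> 0"
  proof (rule B_squeeze[OF _ B_off_mass_drain_total])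
    fix N :: nat and \<eta> :: "'a \<Rightarrow> nat"
    have "off_mass N \<eta> * (bias x y * (dens N \<eta> x * dens N \<eta> y)) \<le> off_mass N \<eta> * drain_total N \<eta>"
      by (intro mult_left_mono pair_le_drain_total x y off_mass_nonneg)
    then show "\<bar>bias x y * (off_mass N \<eta> * (dens N \<eta> x * dens N \<eta> y))\<bar> \<le> 1 * (off_mass N \<eta> * drain_total N \<eta>)"
      using c by (simp add: abs_mult dens_nonneg off_mass_nonneg mult_ac)
  qed
  have inner: "(\<lambda>N. \<Sum>a\<in>A - {x}. (bias x y - bias a y) * B N (\<lambda>\<eta>. dens N \<eta> x * dens N \<eta> a * dens N \<eta> y)) \<longlonglongrightarrow> 0"
    by (intro tendsto_null_sum tendsto_mult_right_zero B_triple x y c) auto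
  \<comment> \<open>Multiply by the total density 1 and compare with
    \<open>dens N \<eta> x * drain N y \<eta>\<close>: the terms \<open>a = x\<close> agree, the
    other sites of \<open>A\<close> leave triple products, and the complement leaves
    \<open>off_mass\<close>.\<close>
  have split: "bias x y * (dens N \<eta> x * dens N \<eta> y) = dens N \<eta> x * drain N y \<eta>
      + (\<Sum>a\<in>A - {x}. (bias x y - bias a y) * (dens N \<eta> x * dens N \<eta> a * dens N \<eta> y))
      + bias x y * (off_mass N \<eta> * (dens N \<eta> x * dens N \<eta> y))" if N: "N > 0" and \<eta>: "\<eta> \<in> configs N" for N \<eta>
  proof -
    have "(\<Sum>a\<in>UNIV. dens N \<eta> a) = off_mass N \<eta> + (\<Sum>a\<in>A. dens N \<eta> a)"
      unfolding off_mass_def by (subst sum.subset_diff[of A UNIV]) (auto simp: Compl_eq_Diff_UNIV)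
    then have one: "1 - off_mass N \<eta> = (\<Sum>a\<in>A. dens N \<eta> a)" using sum_dens[OF N \<eta>] by simp
    have "bias x y * (dens N \<eta> x * dens N \<eta> y) - bias x y * (off_mass N \<eta> * (dens N \<eta> x * dens N \<eta> y))
      = (1 - off_mass N \<eta>) * (bias x y * (dens N \<eta> x * dens N \<eta> y))" by (simp add: algebra_simps)
    also have "\<dots> = (\<Sum>a\<in>A. bias x y * (dens N \<eta> x * dens N \<eta> a * dens N \<eta> y))"
      unfolding one sum_distrib_right by (simp add: mult_ac)
    finally have lhs: "bias x y * (dens N \<eta> x * dens N \<eta> y) - bias x y * (off_mass N \<eta> * (dens N \<eta> x * dens N \<eta> y))
      = (\<Sum>a\<in>A. bias x y * (dens N \<eta> x * dens N \<eta> a * dens N \<eta> y))" .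
    have "(\<Sum>a\<in>A. bias x y * (dens N \<eta> x * dens N \<eta> a * dens N \<eta> y)) - dens N \<eta> x * drain N y \<eta> = (\<Sum>a\<in>A. (bias x y - bias a y) * (dens N \<eta> x * dens N \<eta> a * dens N \<eta> y))"
      unfolding drain_def sum_distrib_left sum_subtractf[symmetric] by (simp add: algebra_simps)
    also have "\<dots> = (\<Sum>a\<in>A - {x}. (bias x y - bias a y) * (dens N \<eta> x * dens N \<eta> a * dens N \<eta> y))"
      using x by (subst sum.remove[of A x]) auto
    finally show ?thesis using lhs by linarith
  qed
  have "bias x y * B N (\<lambda>\<eta>. dens N \<eta> x * dens N \<eta> y) = B N (\<lambda>\<eta>. dens N \<eta> x * drain N y \<eta>)
      + (\<Sum>a\<in>A - {x}. (bias x y - bias a y) * B N (\<lambda>\<eta>. dens N \<eta> x * dens N \<eta> a * dens N \<eta> y))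
      + B N (\<lambda>\<eta>. bias x y * (off_mass N \<eta> * (dens N \<eta> x * dens N \<eta> y)))" if N: "N > 0" for N
  proof -
    have "bias x y * B N (\<lambda>\<eta>. dens N \<eta> x * dens N \<eta> y) = B N (\<lambda>\<eta>. bias x y * (dens N \<eta> x * dens N \<eta> y))"
      by (simp only: B_cmult)
    also have "\<dots> = B N (\<lambda>\<eta>. dens N \<eta> x * drain N y \<eta>
      + (\<Sum>a\<in>A - {x}. (bias x y - bias a y) * (dens N \<eta> x * dens N \<eta> a * dens N \<eta> y))
      + bias x y * (off_mass N \<eta> * (dens N \<eta> x * dens N \<eta> y)))"
      by (rule B_cong) (rule split[OF N])
    also have "\<dots> = B N (\<lambda>\<eta>. dens N \<eta> x * drain N y \<eta>)
      + (\<Sum>a\<in>A - {x}. (bias x y - bias a y) * B N (\<lambda>\<eta>. dens N \<eta> x * dens N \<eta> a * dens N \<eta> y))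
      + B N (\<lambda>\<eta>. bias x y * (off_mass N \<eta> * (dens N \<eta> x * dens N \<eta> y)))"
      unfolding B_add B_sum B_cmult ..
    finally show ?thesis .
  qed
  then have ev: "\<forall>\<^sub>F N in sequentially. (B N (\<lambda>\<eta>. dens N \<eta> x * drain N y \<eta>) - p N x * r x y)
      + (\<Sum>a\<in>A - {x}. (bias x y - bias a y) * B N (\<lambda>\<eta>. dens N \<eta> x * dens N \<eta> a * dens N \<eta> y))
      + B N (\<lambda>\<eta>. bias x y * (off_mass N \<eta> * (dens N \<eta> x * dens N \<eta> y)))
      = bias x y * B N (\<lambda>\<eta>. dens N \<eta> x * dens N \<eta> y) - p N x * r x y"
    by (intro eventually_mono[OF eventually_gt_at_top[of 0]]) simp
  from tendsto_add[OF tendsto_add[OF B_dens_drain[OF x y] inner] outer] ev show ?thesis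
    by (simp add: Lim_transform_eventually)
qed

text \<open>Test with the density at \<open>x\<close>. By \<open>B_pair_limit\<close> the return
  flow cancels the diffusive loss of \<open>x\<close> to the complement, and the diffusive gain from
  there vanishes by \<open>p_off\<close>.\<close>

lemma p_balance_on_A:
  assumes x: "x \<in> A"
  shows "(\<lambda>N. \<Sum>a\<in>A. p N a * r a x - p N x * r x a) \<longlonglongrightarrow> 0"
proof -
  have "(\<Sum>b\<in>UNIV. r z b * incr (ind x) z b) = r z x - of_bool (z = x) * (\<Sum>b\<in>UNIV. r x b)" for z
    by (cases "z = x") (simp_all add: incr_def ind_def right_diff_distrib sum_subtractf)
  then have "p N z * (\<Sum>b\<in>UNIV. r z b * incr (ind x) z b)
      = p N z * r z x - (p N z * (\<Sum>b\<in>UNIV. r x b)) * of_bool (z = x)" for N z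
    by (simp only: right_diff_distrib mult_ac)
  then have P: "(\<Sum>z\<in>UNIV. p N z * (\<Sum>b\<in>UNIV. r z b * incr (ind x) z b))
      = (\<Sum>a\<in>UNIV. p N a * r a x - p N x * r x a)" for N
    by (simp only: sum_subtractf) (simp add: sum_distrib_left)
  have "(\<lambda>N. B N (\<lambda>\<eta>. pair_sum N (incr (ind x)) \<eta>) + (\<Sum>a\<in>UNIV. p N a * r a x - p N x * r x a)) \<longlonglongrightarrow> 0"
    unfolding P[symmetric] by (intro linear_balance ind_bound)
  then have "(\<lambda>N. (\<Sum>b\<in>- A. bias x b * B N (\<lambda>\<eta>. dens N \<eta> x * dens N \<eta> b))
      + (\<Sum>a\<in>UNIV. p N a * r a x - p N x * r x a)) \<longlonglongrightarrow> 0"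
    unfolding pair_sum_ind_in[OF x] B_sum B_cmult .
  moreover have "(\<lambda>N. \<Sum>b\<in>- A. bias x b * B N (\<lambda>\<eta>. dens N \<eta> x * dens N \<eta> b) - p N x * r x b) \<longlonglongrightarrow> 0"
    by (intro tendsto_null_sum B_pair_limit x) auto
  moreover have "(\<lambda>N. \<Sum>b\<in>- A. p N b * r b x) \<longlonglongrightarrow> 0"
    by (intro tendsto_null_sum tendsto_mult_left_zero p_off) auto
  ultimately have "(\<lambda>N. ((\<Sum>b\<in>- A. bias x b * B N (\<lambda>\<eta>. dens N \<eta> x * dens N \<eta> b))
      + (\<Sum>a\<in>UNIV. p N a * r a x - p N x * r x a))
      - (\<Sum>b\<in>- A. bias x b * B N (\<lambda>\<eta>. dens N \<eta> x * dens N \<eta> b) - p N x * r x b)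
      - (\<Sum>b\<in>- A. p N b * r b x)) \<longlonglongrightarrow> 0 - 0 - 0"
    by (intro tendsto_diff)
  moreover have "((\<Sum>b\<in>- A. bias x b * B N (\<lambda>\<eta>. dens N \<eta> x * dens N \<eta> b))
      + (\<Sum>a\<in>UNIV. p N a * r a x - p N x * r x a))
      - (\<Sum>b\<in>- A. bias x b * B N (\<lambda>\<eta>. dens N \<eta> x * dens N \<eta> b) - p N x * r x b)
      - (\<Sum>b\<in>- A. p N b * r b x) = (\<Sum>a\<in>A. p N a * r a x - p N x * r x a)" for N
  proof -
    have "(\<Sum>a\<in>UNIV. p N a * r a x - p N x * r x a)
     = (\<Sum>a\<in>- A. p N a * r a x - p N x * r x a) + (\<Sum>a\<in>A. p N a * r a x - p N x * r x a)"
      by (subst sum.subset_diff[of A UNIV]) (auto simp: Compl_eq_Diff_UNIV)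
    then show ?thesis by (simp add: sum_subtractf)
  qed
  ultimately show ?thesis by simp
qed

end

theorem theorem3p13:
  fixes r :: "'a::finite \<Rightarrow> 'a \<Rightarrow> real"
    and d :: "nat \<Rightarrow> real"
    and \<mu> :: "nat \<Rightarrow> ('a \<Rightarrow> nat) \<Rightarrow> real"
  assumes "rates r"
    and "irreducible_on UNIV r"
    and "\<forall>N. d N > 0"
    and "(\<lambda>N. d N * ln (real N)) \<longlonglongrightarrow> 0"
    and "\<forall>N. inv_prob_IP r (d N) N (\<mu> N)"
    and "condensation \<mu>"
  shows "(irreducible_on (S0 r) (brates r) \<longrightarrow>
            Sstar \<mu> = S0 r \<and>
            (\<exists>!\<nu>. inv_prob_on (Sstar \<mu>) (brates r) \<nu>) \<and>
            (\<forall>\<nu>. inv_prob_on (Sstar \<mu>) (brates r) \<nu> \<longrightarrow>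
                 (\<forall>x\<in>Sstar \<mu>. (\<lambda>N. \<mu> N (xi N x)) \<longlonglongrightarrow> \<nu> x)))
       \<and> ((\<forall>x\<in>S0 r. \<forall>y\<in>S0 r. r x y = r y x) \<and> irreducible_on (S0 r) r \<and> attracting r (S0 r) \<longrightarrow>
            Sstar \<mu> = S0 r \<and>
            (\<exists>!\<nu>. inv_prob_on (Sstar \<mu>) r \<nu>) \<and>
            (\<forall>\<nu>. inv_prob_on (Sstar \<mu>) r \<nu> \<longrightarrow>
                 (\<forall>x\<in>Sstar \<mu>. (\<lambda>N. \<mu> N (xi N x)) \<longlonglongrightarrow> \<nu> x)))"
proof -
  interpret condensing_inclusion r d \<mu>
    using assms by unfold_locales auto
  have bd: "\<bar>\<mu> N (xi N x)\<bar> \<le> 1" for N x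
    using p_nonneg[of N x] p_le_1[of N x] by (simp add: p_def)
  show ?thesis
  \<comment> \<open>The pattern splits only the outer conjunction, whose left side is an
    implication, and keeps each conclusion whole.\<close>
  proof (intro conjI[of "_ \<longrightarrow> _"] impI)
    assume "irreducible_on (S0 r) (brates r)"
    then show "Sstar \<mu> = S0 r \<and> (\<exists>!\<nu>. inv_prob_on (Sstar \<mu>) (brates r) \<nu>) \<and>
        (\<forall>\<nu>. inv_prob_on (Sstar \<mu>) (brates r) \<nu> \<longrightarrow>
          (\<forall>x\<in>Sstar \<mu>. (\<lambda>N. \<mu> N (xi N x)) \<longlonglongrightarrow> \<nu> x))"
      using subseq_limit_inv_prob_on_S0[unfolded p_def]
      by (rule convergence_from_subseq_limits[of "S0 r" "brates r" \<mu> 1, OF _ brates_nonneg bd])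
  next
    assume sym_irr: "(\<forall>x\<in>S0 r. \<forall>y\<in>S0 r. r x y = r y x) \<and> irreducible_on (S0 r) r \<and> attracting r (S0 r)"
    then interpret attracting_condensation r d \<mu> "S0 r"
      by unfold_locales (auto intro: p_transient_tendsto_0)
    have inv: "inv_prob_on (S0 r) r q"
      if s: "strict_mono s" and lim: "\<And>x. (\<lambda>k. p (s k) x) \<longlonglongrightarrow> q x" for s q
    proof -
      \<comment> \<open>From this only nonnegativity, support and total mass are kept. Its balance
        equations are void, since \<open>brates r\<close> vanishes on \<open>S0 r\<close> for
        symmetric rates, and are replaced by those for \<open>r\<close>.\<close>
      have b: "inv_prob_on (S0 r) (brates r) q" using s lim by (rule subseq_limit_inv_prob_on_S0)
      have "(\<Sum>x\<in>S0 r - {y}. q x * r x y) = q y * (\<Sum>z\<in>S0 r - {y}. r y z)" if y: "y \<in> S0 r" for y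
      proof -
        have "(\<lambda>k. \<Sum>a\<in>S0 r. p (s k) a * r a y - p (s k) y * r y a) \<longlonglongrightarrow> 0"
          using LIMSEQ_subseq_LIMSEQ[OF p_balance_on_A[OF y] s] by (simp add: o_def)
        moreover have "(\<lambda>k. \<Sum>a\<in>S0 r. p (s k) a * r a y - p (s k) y * r y a)
            \<longlonglongrightarrow> (\<Sum>a\<in>S0 r. q a * r a y - q y * r y a)"
          by (intro tendsto_intros lim)
        ultimately have "(\<Sum>a\<in>S0 r. q a * r a y - q y * r y a) = 0"
          using LIMSEQ_unique by blast
        then have "(\<Sum>a\<in>S0 r - {y}. q a * r a y - q y * r y a) = 0"
          using y by (simp add: sum_diff1)
        then show ?thesis by (simp add: sum_subtractf sum_distrib_left)
      qed
      then show ?thesis using b by (simp add: inv_prob_on_def)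
    qed
    have "irreducible_on (S0 r) r" using sym_irr by blast
    then show "Sstar \<mu> = S0 r \<and> (\<exists>!\<nu>. inv_prob_on (Sstar \<mu>) r \<nu>) \<and>
        (\<forall>\<nu>. inv_prob_on (Sstar \<mu>) r \<nu> \<longrightarrow>
          (\<forall>x\<in>Sstar \<mu>. (\<lambda>N. \<mu> N (xi N x)) \<longlonglongrightarrow> \<nu> x))"
      using inv[unfolded p_def] by (rule convergence_from_subseq_limits[of "S0 r" r \<mu> 1, OF _ r_nonneg bd])
  qed
qed

end
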